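(* Let $N\in\{2,3\}$ and let $f$ be a quasi-modular form of weight $k$ and depth $1$ for $\Gamma_0^+(N)$, i.e. $f=f_0+f_1E_2^{(N)}$ where $f_0$ and $f_1$ are holomorphic modular forms for $\Gamma_0^+(N)$ of weights $k$ and $k-2$ respectively and $f_1$ is not identically zero. Then $f$ has infinitely many $\Gamma_0^+(N)$-inequivalent zeros in $\mathbb{H}$.
   Context: $\mathbb{H}$ is the upper half-plane and $q=e^{2\pi i\tau}$. $\Gamma_0^+(N)\subset\mathrm{SL}_2(\mathbb{R})$ is the group generated by the Hecke congruence subgroup $\Gamma_0(N)$ and the Fricke involution $w_N=\begin{pmatrix}0&-1/\sqrt N\\ \sqrt N&0\end{pmatrix}$. $E_2(\tau)=1-24\sum_{n\ge1}\sigma_1(n)q^n$ with $\sigma_1(n)=\sum_{d\mid n}d$, and $E_2^{(N)}(\tau)=\frac{1}{1+N}\left(E_2(\tau)+NE_2(N\tau)\right)$. *)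

theory Defs
  imports "HOL-Complex_Analysis.Complex_Analysis" "HOL-Algebra.Generated_Groups"
begin

definition upper_half_plane :: "complex set" where
  "upper_half_plane = {\<tau>. Im \<tau> > 0}"

definition SL2R :: "(real^2^2) monoid" where
  "SL2R = \<lparr>carrier = {A. det A = 1}, mult = (**), one = mat 1\<rparr>"

definition SL2Z :: "(real^2^2) set" where
  "SL2Z = {A \<in> carrier SL2R. \<forall>i j. A $ i $ j \<in> \<int>}"

definition Gamma0 :: "nat \<Rightarrow> (real^2^2) set" where
  "Gamma0 N = {A \<in> SL2Z. \<exists>m::int. A $ 2 $ 1 = of_nat N * of_int m}"

definition fricke :: "nat \<Rightarrow> real^2^2" where
  "fricke N = vector [vector [0, - 1 / sqrt (of_nat N)], vector [sqrt (of_nat N), 0]]"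

definition Gamma0_plus :: "nat \<Rightarrow> (real^2^2) set" where
  "Gamma0_plus N = generate SL2R (insert (fricke N) (Gamma0 N))"

lemma group_SL2R: "group SL2R"
proof (rule groupI)
  fix A assume "A \<in> carrier SL2R"
  then have d: "det A = 1" by (simp add: SL2R_def)
  then obtain B where B: "A ** B = mat 1" "B ** A = mat 1"
    by (metis invertible_det_nz invertible_def zero_neq_one)
  have "det B = 1" using det_mul[of A B] B d by simp
  with B show "\<exists>y\<in>carrier SL2R. y \<otimes>\<^bsub>SL2R\<^esub> A = \<one>\<^bsub>SL2R\<^esub>"
    by (auto simp: SL2R_def)
qed (auto simp: SL2R_def det_mul matrix_mul_assoc)

lemma fricke_in_SL2R: "N > 0 \<Longrightarrow> fricke N \<in> carrier SL2R"
  by (simp add: SL2R_def fricke_def det_2)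

definition aut_factor :: "real^2^2 \<Rightarrow> complex \<Rightarrow> complex" where
  "aut_factor A \<tau> = of_real (A $ 2 $ 1) * \<tau> + of_real (A $ 2 $ 2)"

definition moeb :: "real^2^2 \<Rightarrow> complex \<Rightarrow> complex" where
  "moeb A \<tau> = (of_real (A $ 1 $ 1) * \<tau> + of_real (A $ 1 $ 2)) / aut_factor A \<tau>"

definition slash :: "int \<Rightarrow> (complex \<Rightarrow> complex) \<Rightarrow> real^2^2 \<Rightarrow> complex \<Rightarrow> complex" where
  "slash k f A \<tau> = aut_factor A \<tau> powi (- k) * f (moeb A \<tau>)"

definition orbit_rel :: "(real^2^2) set \<Rightarrow> (complex \<times> complex) set" where
  "orbit_rel G = {(\<tau>, \<tau>'). \<tau> \<in> upper_half_plane \<and> \<tau>' \<in> upper_half_plane \<and>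
                           (\<exists>A\<in>G. \<tau>' = moeb A \<tau>)}"

text \<open>
  Holomorphy at the cusps is expressed as boundedness of \<open>f|\<^sub>k A\<close> for \<open>Im \<tau> \<rightarrow> \<infinity>\<close>, for every
  \<open>A \<in> SL\<^sub>2(\<int>)\<close>. This covers all cusps provided that \<open>G\<close> is commensurable with \<open>SL\<^sub>2(\<int>)\<close>, so that
  its cusps are the points of \<open>\<rat> \<union> {\<infinity>}\<close>; \<open>Gamma0_plus N\<close> is such a group for \<open>N > 0\<close>.
\<close>

definition modular_form :: "(real^2^2) set \<Rightarrow> int \<Rightarrow> (complex \<Rightarrow> complex) \<Rightarrow> bool" where
  "modular_form G k f \<longleftrightarrow>
     f holomorphic_on upper_half_plane \<and>
     (\<forall>A\<in>G. \<forall>\<tau>\<in>upper_half_plane. slash k f A \<tau> = f \<tau>) \<and>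
     (\<forall>A\<in>SL2Z. Bfun (slash k f A) (filtercomap Im at_top))"

definition sigma1 :: "nat \<Rightarrow> nat" where
  "sigma1 n = \<Sum>{d. d dvd n}"

definition E2 :: "complex \<Rightarrow> complex" where
  "E2 \<tau> = 1 - 24 * (\<Sum>n. of_nat (sigma1 (Suc n)) * exp (2 * of_real pi * \<i> * \<tau>) ^ Suc n)"

definition E2N :: "nat \<Rightarrow> complex \<Rightarrow> complex" where
  "E2N N \<tau> = 1 / (1 + of_nat N) * (E2 \<tau> + of_nat N * E2 (of_nat N * \<tau>))"

definition quasimodular_form_depth1 :: "nat \<Rightarrow> int \<Rightarrow> (complex \<Rightarrow> complex) \<Rightarrow> bool" where
  "quasimodular_form_depth1 N k f \<longleftrightarrow>
     (\<exists>f0 f1. modular_form (Gamma0_plus N) k f0 \<and>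
              modular_form (Gamma0_plus N) (k - 2) f1 \<and>
              (\<exists>\<tau>\<in>upper_half_plane. f1 \<tau> \<noteq> 0) \<and>
              (\<forall>\<tau>\<in>upper_half_plane. f \<tau> = f0 \<tau> + f1 \<tau> * E2N N \<tau>))"

end

theory Submission
  imports Defs
begin

text \<open>
  Put \<open>C = 12/(\<pi>\<i>(1 + N))\<close>, \<open>p = \<tau> f + C f\<^sub>1\<close> and \<open>h = p/f\<close>. The transformation law of \<open>E2\<close> makes
  \<open>h\<close> commute with \<open>\<tau> \<mapsto> \<tau> + 1\<close> and \<open>\<tau> \<mapsto> -1/(N\<tau>)\<close>, and \<open>f\<close> vanishes where \<open>h = \<infinity>\<close>. Hence, if \<open>h\<close> takes at
  \<open>\<tau>\<close> a value in the orbit of \<open>\<infinity>\<close>, then \<open>\<tau>\<close> is equivalent to a zero of \<open>f\<close>. These cusps are dense in the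
  real line, so once \<open>h\<close> takes a single real value, the open mapping theorem yields infinitely many such
  \<open>\<tau>\<close> in a small disc, and an orbit meets a disc only finitely often.

  If \<open>h\<close> took no real value, then \<open>h\<close> or \<open>-h\<close> would be a holomorphic self-map of the upper half-plane
  that fixes the elliptic point \<open>\<i>/\<surd>N\<close> and sends \<open>\<i>/\<surd>N + n\<close> to \<open>\<i>/\<surd>N \<plusminus> n\<close>. The equality case of the
  Schwarz lemma excludes the minus sign and gives \<open>h \<tau> = \<tau>\<close>, that is \<open>f\<^sub>1 = 0\<close>, for the plus sign.
\<close>

text \<open>The term that keeps \<open>E2N N\<close> from being modular under the involution is
  linear in \<tau>. Adding \<open>C f1\<close> to \<open>\<tau> f\<close> absorbs it, so the
  involution exchanges \<open>f\<close> and \<open>p\<close> up to constants and a common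
  nonvanishing factor \<open>J\<close>, whatever the weight. That is the equivariance of
  \<open>h\<close>. Since \<open>h\<close> may have poles, all laws are carried as identities
  between \<open>p\<close> and \<open>f\<close>. A holomorphic function \<open>G\<close> appears
  only after the absence of real values has excluded the poles. Only the translation and the
  involution ever act on \<open>h\<close>; the whole group enters through the discreteness of its
  orbits. The law of \<open>E2\<close> is derived from its q-series by comparing the zeta functions
  of two proportional lattices.\<close>

text \<open>Otherwise every \<open>$\<close> below has two parses, and parse trees multiply exponentially.\<close>
no_notation fps_nth (infixl "$" 75)

section \<open>Density of the cusps\<close>

text \<open>The finite part of the orbit of \<infinity>: it starts at 0, the image of \<infinity>
  under the involution, and \<open>x \<noteq> 0\<close> prevents a return to \<infinity>. Being
  inductive, it lets \<open>zero_in_orbit_if_value_is_cusp\<close> walk back one generator at a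
  time.\<close>

inductive_set fricke_cusps :: "real \<Rightarrow> real set" for N :: real where
  zero: "0 \<in> fricke_cusps N"
| add1: "x \<in> fricke_cusps N \<Longrightarrow> x + 1 \<in> fricke_cusps N"
| diff1: "x \<in> fricke_cusps N \<Longrightarrow> x - 1 \<in> fricke_cusps N"
| invol: "x \<in> fricke_cusps N \<Longrightarrow> x \<noteq> 0 \<Longrightarrow> - 1 / (N * x) \<in> fricke_cusps N"

lemma fricke_cusps_add_int: "x \<in> fricke_cusps N \<Longrightarrow> x + of_int m \<in> fricke_cusps N"
proof (induction m rule: int_induct[of _ 0])
  case (step1 i) then show ?case using fricke_cusps.add1[of "x + of_int i"] by (simp add: algebra_simps)
next
  case (step2 i) then show ?case using fricke_cusps.diff1[of "x + of_int i"] by (simp add: algebra_simps)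
qed simp

lemma fricke_cusps_int: "of_int m \<in> fricke_cusps N"
  using fricke_cusps_add_int[OF fricke_cusps.zero, of m N] by simp

text \<open>With 1/2 all half integers are cusps. A gap between cusps then fits, after an integer
  shift, into [0, 1/2] or [-1/2, 0], where the involution expands.\<close>

lemma half_in_fricke_cusps:
  assumes "N \<in> {2, 3}" shows "1/2 \<in> fricke_cusps N"
proof -
  have a: "- 1 / N \<in> fricke_cusps N"
    using fricke_cusps.invol[OF fricke_cusps_int[of 1 N]] by simp
  show ?thesis
  proof (cases "N = 2")
    case True then show ?thesis using fricke_cusps.add1[OF a] by simp
  next
    case False
    then have N: "N = 3" using assms by auto
    have "1/3 \<in> fricke_cusps N" using fricke_cusps.invol[OF fricke_cusps_int[of "-1" N]] N by simp
    then have "-2/3 \<in> fricke_cusps N" using fricke_cusps.diff1[of "1/3" N] by simp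
    from fricke_cusps.invol[OF this] show ?thesis using N by simp
  qed
qed

lemma half_int_in_fricke_cusps:
  assumes "N \<in> {2, 3}" shows "of_int m / 2 \<in> fricke_cusps N"
proof (cases "even m")
  case True
  then obtain j where "m = 2 * j" by auto
  then show ?thesis using fricke_cusps_int[of j N] by simp
next
  case False
  then obtain j where "m = 2 * j + 1" by (auto elim: oddE)
  then show ?thesis using fricke_cusps_add_int[OF half_in_fricke_cusps[OF assms], of j]
    by (simp add: add_divide_distrib algebra_simps)
qed

text \<open>On \<open>0 < \<bar>x\<bar> \<le> 1/2\<close> the map \<open>x \<mapsto> -1/(N x)\<close> expands by at least \<open>4/N \<ge> 4/3\<close>, so a gap
  in the set of cusps could be blown up until it contains a half integer.\<close>
lemma fricke_cusps_meet_interval: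
  assumes N: "N \<in> {2, 3}" and "(3/4)^n \<le> b - a"
  shows "\<exists>x\<in>fricke_cusps N. a < x \<and> x < b"
  using assms(2)
proof (induction n arbitrary: a b)
  case 0
  \<comment> \<open>Here the interval has length at least 1, and \<open>m / 2\<close>, the first
    half integer beyond \<open>a\<close>, is at most \<open>a + 1/2\<close>.\<close>
  define m where "m = \<lfloor>2 * a\<rfloor> + 1"
  have "2 * a < of_int m" "of_int m \<le> 2 * a + 1" unfolding m_def by linarith+
  then show ?case using 0 half_int_in_fricke_cusps[OF N, of m]
    by (intro bexI[of _ "of_int m / 2"]) auto
next
  case (Suc n)
  have Npos: "N > 0" "N \<le> 3" using N by auto
  have pow: "(3/4)^n \<le> 4/3 * (b - a)" "0 < b - a"
    using Suc.prems by auto (smt (verit) zero_less_power zero_less_divide_iff mult_pos_pos)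
  show ?case
  proof (cases "\<exists>m::int. a < of_int m / 2 \<and> of_int m / 2 < b")
    case True
    then show ?thesis using half_int_in_fricke_cusps[OF N] by blast
  next
    case False
    define m where "m = \<lfloor>2 * a\<rfloor>"
    have "of_int m \<le> 2 * a" "2 * a < of_int m + 1"
      unfolding m_def by (rule of_int_floor_le, rule real_of_int_floor_add_one_gt)
    then have ma: "of_int m / 2 \<le> a" "a < (of_int m + 1) / 2" by auto
    have mb: "b \<le> (of_int m + 1) / 2"
      using False[simplified not_ex, rule_format, of "m + 1"] ma by auto
    \<comment> \<open>The interval lies in the cell from \<open>m / 2\<close> to
      \<open>(m + 1) / 2\<close>; \<open>j\<close> is the integer end of this cell, and subtracting
      it moves that end to 0.\<close>
    define j where "j = (if even m then m div 2 else (m + 1) div 2)"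
    define a' where "a' = a - of_int j"
    define b' where "b' = b - of_int j"
    have j: "m = 2 * j \<or> m + 1 = 2 * j" unfolding j_def by (auto elim: oddE)
    then have cases: "(0 \<le> a' \<and> b' \<le> 1/2) \<or> (-1/2 \<le> a' \<and> b' \<le> 0)"
    proof
      assume "m = 2 * j" then have "of_int m = 2 * (of_int j :: real)" by simp
      then show ?thesis using ma mb unfolding a'_def b'_def by (intro disjI1) simp
    next
      assume "m + 1 = 2 * j" then have "of_int m + 1 = 2 * (of_int j :: real)"
        by (metis of_int_1 of_int_add of_int_mult of_int_numeral)
      then have "of_int m = 2 * (of_int j :: real) - 1" by simp
      then show ?thesis using ma mb unfolding a'_def b'_def by (intro disjI2) simp
    qed
    have ab': "a' < b'" "b' - a' = b - a" using pow unfolding a'_def b'_def by auto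
    have "\<exists>x\<in>fricke_cusps N. a' < x \<and> x < b'"
    proof -
      \<comment> \<open>An end at 0 would be sent to \<infinity>, leaving no bounded interval for
        the induction. In that case the images \<open>\<mp>1 / (N * i)\<close> of integers
        accumulate at 0 and one of them lies in the interval.\<close>
      consider "a' = 0" | "b' = 0" | "0 < a'" "b' \<le> 1/2" | "-1/2 \<le> a'" "b' < 0"
        using cases by linarith
      then show ?thesis
      proof cases
        case 1
        obtain i :: nat where i: "1 / (N * b') < real i"
          using reals_Archimedean2 by blast
        have "0 < real i" using i ab' 1 Npos by (smt (verit) divide_pos_pos mult_pos_pos)
        with i ab' 1 Npos have "1 / (N * real i) < b'" "0 < 1 / (N * real i)"
          by (auto simp: field_simps)
        then show ?thesis using 1 \<open>0 < real i\<close> fricke_cusps.invol[OF fricke_cusps_int[of "- int i" N]]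
          by (intro bexI[of _ "1 / (N * real i)"]) auto
      next
        case 2
        obtain i :: nat where i: "1 / (N * - a') < real i"
          using reals_Archimedean2 by blast
        define c where "c = - a'"
        have c: "a' = - c" "c > 0" using ab' 2 unfolding c_def by auto
        have "1 / (N * c) < real i" using i unfolding c_def .
        note c = c this
        have "0 < real i" using c Npos by (smt (verit) divide_pos_pos mult_pos_pos)
        with c Npos have "1 / (N * real i) < - a'" "0 < 1 / (N * real i)"
          by (auto simp: field_simps)
        then show ?thesis using 2 \<open>0 < real i\<close> fricke_cusps.invol[OF fricke_cusps_int[of "int i" N]]
          by (intro bexI[of _ "-1 / (N * real i)"]) auto
      next
        case 3
        \<comment> \<open>The image interval has length \<open>(b' - a') / (N * (a' * b'))\<close>.
          As both ends are at most 1/2 in modulus, this gains at least the factor 4/3, which pays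
          for one power of 3/4.\<close>
        have ab: "0 < a' * b'" "a' * b' \<le> 1/4"
          using 3 ab' mult_mono[of a' "1/2" b' "1/2"] by auto
        have "N * (a' * b') \<le> 3 * (1/4)" using ab Npos by (intro mult_mono) auto
        have "(3/4)^n \<le> (b' - a') / (3/4)" using pow ab' by simp
        also have "\<dots> \<le> (b' - a') / (N * (a' * b'))"
          using ab ab' Npos \<open>N * (a' * b') \<le> _\<close> by (intro divide_left_mono) auto
        also have "\<dots> = - 1 / (N * b') - (- 1 / (N * a'))" using 3 ab' Npos by (simp add: field_simps)
        finally have "(3/4)^n \<le> - 1 / (N * b') - (- 1 / (N * a'))" .
        from Suc.IH[OF this] obtain y where y: "y \<in> fricke_cusps N" "- 1 / (N * a') < y" "y < - 1 / (N * b')"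
          by auto
        have "y < 0" using y(3) 3 ab' Npos by (smt (verit) divide_neg_pos mult_pos_pos)
        have "a' < - 1 / (N * y)" "- 1 / (N * y) < b'"
          using y \<open>y < 0\<close> 3 ab' Npos by (auto simp: field_simps mult_less_0_iff)
        then show ?thesis using fricke_cusps.invol[OF y(1)] \<open>y < 0\<close> by blast
      next
        case 4
        have ab: "0 < a' * b'" "a' * b' \<le> 1/4"
          using 4 ab' mult_mono[of "-a'" "1/2" "-b'" "1/2"] by (auto simp: mult_neg_neg)
        have "N * (a' * b') \<le> 3 * (1/4)" using ab Npos by (intro mult_mono) auto
        have "(3/4)^n \<le> (b' - a') / (3/4)" using pow ab' by simp
        also have "\<dots> \<le> (b' - a') / (N * (a' * b'))"
          using ab ab' Npos \<open>N * (a' * b') \<le> _\<close> by (intro divide_left_mono) auto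
        also have "\<dots> = - 1 / (N * b') - (- 1 / (N * a'))" using 4 ab' Npos by (simp add: field_simps)
        finally have "(3/4)^n \<le> - 1 / (N * b') - (- 1 / (N * a'))" .
        from Suc.IH[OF this] obtain y where y: "y \<in> fricke_cusps N" "- 1 / (N * a') < y" "y < - 1 / (N * b')"
          by auto
        have "0 < - 1 / (N * a')" using 4 ab' Npos by (simp add: field_simps mult_less_0_iff)
        then have "y > 0" using y(2) by linarith
        have "a' < - 1 / (N * y)" "- 1 / (N * y) < b'"
          using y \<open>y > 0\<close> 4 ab' Npos by (auto simp: field_simps mult_less_0_iff)
        then show ?thesis using fricke_cusps.invol[OF y(1)] \<open>y > 0\<close> by blast
      qed
    qed
    then obtain x where "x \<in> fricke_cusps N" "a' < x" "x < b'" by auto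
    then show ?thesis using fricke_cusps_add_int[of x N j] unfolding a'_def b'_def
      by (intro bexI[of _ "x + of_int j"]) auto
  qed
qed

lemma infinite_fricke_cusps_interval:
  assumes N: "N \<in> {2, 3}" and "a < b"
  shows "infinite {x \<in> fricke_cusps N. a < x \<and> x < b}"
proof
  have dense: "\<exists>x\<in>fricke_cusps N. u < x \<and> x < v" if "u < v" for u v
  proof -
    obtain n where "(3/4::real)^n < v - u" using real_arch_pow_inv[of "v - u" "3/4"] \<open>u < v\<close> by auto
    then show ?thesis using fricke_cusps_meet_interval[OF N, of n] by simp
  qed
  let ?S = "{x \<in> fricke_cusps N. a < x \<and> x < b}"
  assume fin: "finite ?S"
  obtain x where "x \<in> ?S" using dense[OF assms(2)] by auto
  then have "Min ?S \<in> ?S" using fin by (intro Min_in) auto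
  then obtain y where "y \<in> fricke_cusps N" "a < y" "y < Min ?S" using dense[of a "Min ?S"] by auto
  then show False using Min_le[OF fin, of y] \<open>Min ?S \<in> ?S\<close> by fastforce
qed

section \<open>Discreteness of the group\<close>

lemma matrix_mult_2:
  fixes A B :: "real^2^2"
  shows "(A ** B) $ i $ j = A $ i $ 1 * B $ 1 $ j + A $ i $ 2 * B $ 2 $ j"
  by (simp add: matrix_matrix_mult_def sum_2)

lemma carrier_SL2R: "A \<in> carrier SL2R \<longleftrightarrow> A $ 1 $ 1 * A $ 2 $ 2 - A $ 1 $ 2 * A $ 2 $ 1 = 1"
  by (simp add: SL2R_def det_2)

lemma aut_factor_nonzero:
  assumes "A \<in> carrier SL2R" "Im \<tau> > 0" shows "aut_factor A \<tau> \<noteq> 0"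
proof
  assume 0: "aut_factor A \<tau> = 0"
  then have "A $ 2 $ 1 * Im \<tau> = 0" by (simp add: aut_factor_def complex_eq_iff)
  then have "A $ 2 $ 1 = 0" using assms by simp
  then show False using 0 assms by (simp add: aut_factor_def complex_eq_iff carrier_SL2R)
qed

lemma moeb_mult:
  assumes "A \<in> carrier SL2R" "B \<in> carrier SL2R" "Im \<tau> > 0"
  shows "moeb (A ** B) \<tau> = moeb A (moeb B \<tau>)"
proof -
  have "aut_factor B \<tau> \<noteq> 0" using aut_factor_nonzero assms by auto
  then have num: "moeb B \<tau> * aut_factor B \<tau> = of_real (B $ 1 $ 1) * \<tau> + of_real (B $ 1 $ 2)"
    by (simp add: moeb_def)
  have eq: "(of_real a * moeb B \<tau> + of_real b) * aut_factor B \<tau> =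
        of_real a * (of_real (B $ 1 $ 1) * \<tau> + of_real (B $ 1 $ 2)) +
        of_real b * (of_real (B $ 2 $ 1) * \<tau> + of_real (B $ 2 $ 2))" for a b
    unfolding num[symmetric] by (simp add: aut_factor_def[of B] algebra_simps)
  have "moeb A (moeb B \<tau>) =
      ((of_real (A $ 1 $ 1) * moeb B \<tau> + of_real (A $ 1 $ 2)) * aut_factor B \<tau>) /
      ((of_real (A $ 2 $ 1) * moeb B \<tau> + of_real (A $ 2 $ 2)) * aut_factor B \<tau>)"
    using \<open>aut_factor B \<tau> \<noteq> 0\<close> by (simp add: moeb_def[of A] aut_factor_def[of A])
  then show ?thesis unfolding eq
    by (simp add: moeb_def[of "A ** B"] aut_factor_def[of "A ** B"] matrix_mult_2 algebra_simps)
qed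

lemma Im_moeb:
  assumes "A \<in> carrier SL2R" "Im \<tau> > 0"
  shows "Im (moeb A \<tau>) = Im \<tau> / (cmod (aut_factor A \<tau>))\<^sup>2"
proof -
  have *: "Im ((of_real a * \<tau> + of_real b) * cnj (of_real c * \<tau> + of_real d)) = (a * d - b * c) * Im \<tau>"
    for a b c d by (simp add: algebra_simps)
  have "Im (moeb A \<tau>) = Im ((of_real (A $ 1 $ 1) * \<tau> + of_real (A $ 1 $ 2)) * cnj (aut_factor A \<tau>)) / (cmod (aut_factor A \<tau>))\<^sup>2"
    unfolding moeb_def complex_div_cnj[of _ "aut_factor A \<tau>"] by (simp only: Im_divide_of_real)
  then show ?thesis unfolding aut_factor_def[of A \<tau>] * using assms(1) by (simp add: carrier_SL2R)
qed

lemma moeb_in_upper_half_plane: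
  assumes "A \<in> carrier SL2R" "\<tau> \<in> upper_half_plane" shows "moeb A \<tau> \<in> upper_half_plane"
  using assms Im_moeb[of A \<tau>] aut_factor_nonzero[of A \<tau>] by (auto simp: upper_half_plane_def)

lemma inv_SL2R:
  assumes "A \<in> carrier SL2R"
  shows "inv\<^bsub>SL2R\<^esub> A = vector [vector [A $ 2 $ 2, - A $ 1 $ 2], vector [- A $ 2 $ 1, A $ 1 $ 1]]"
    (is "_ = ?B")
proof (rule group.inv_equality[OF group_SL2R _ assms])
  have "?B ** A = mat 1" using assms
    by (simp add: vec_eq_iff forall_2 matrix_mult_2 mat_def carrier_SL2R algebra_simps)
  then show "?B \<otimes>\<^bsub>SL2R\<^esub> A = \<one>\<^bsub>SL2R\<^esub>" by (simp add: SL2R_def)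
  show "?B \<in> carrier SL2R" using assms by (simp add: carrier_SL2R algebra_simps)
qed

lemma Gamma0_plus_subset_SL2R: "N > 0 \<Longrightarrow> Gamma0_plus N \<subseteq> carrier SL2R"
  unfolding Gamma0_plus_def
  by (intro group.generate_incl[OF group_SL2R]) (auto simp: fricke_in_SL2R Gamma0_def SL2Z_def)

lemma moeb_inv:
  assumes "A \<in> carrier SL2R" "Im \<tau> > 0"
  shows "moeb (inv\<^bsub>SL2R\<^esub> A) (moeb A \<tau>) = \<tau>"
proof -
  have "inv\<^bsub>SL2R\<^esub> A ** A = mat 1"
    using group.l_inv[OF group_SL2R assms(1)] by (simp add: SL2R_def)
  moreover have "moeb (mat 1) \<tau> = \<tau>" by (simp add: moeb_def aut_factor_def mat_def)
  ultimately show ?thesis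
    using moeb_mult[OF group.inv_closed[OF group_SL2R assms(1)] assms] by simp
qed

text \<open>\<open>Gamma0 N\<close> and its coset under the Fricke involution together are closed under
  multiplication; the two disjuncts describe their entries.\<close>
definition plus_entries :: "nat \<Rightarrow> real^2^2 \<Rightarrow> bool" where
  "plus_entries N A \<longleftrightarrow>
     (\<exists>a b c d :: int. A $ 1 $ 1 = real_of_int a \<and> A $ 1 $ 2 = real_of_int b \<and>
        A $ 2 $ 1 = real N * real_of_int c \<and> A $ 2 $ 2 = real_of_int d) \<or>
     (\<exists>a b c d :: int. A $ 1 $ 1 = sqrt (real N) * real_of_int a \<and> A $ 1 $ 2 = real_of_int b / sqrt (real N) \<and>
        A $ 2 $ 1 = sqrt (real N) * real_of_int c \<and> A $ 2 $ 2 = sqrt (real N) * real_of_int d)"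

lemma plus_entries_mult:
  assumes "N > 0" "plus_entries N A" "plus_entries N B"
  shows "plus_entries N (A ** B)"
proof -
  have s: "sqrt (real N) * sqrt (real N) = real N" "sqrt (real N) > 0" "sqrt (real N) * (sqrt (real N) * x) = real N * x" for x :: real
    using assms by (auto simp flip: mult.assoc)
  have q: "real N * x / sqrt (real N) = sqrt (real N) * x" for x :: real
    by (simp add: real_div_sqrt flip: times_divide_eq_left)
  then have q': "x * (y * real N) / sqrt (real N) = x * (y * sqrt (real N))" for x y :: real
    by (metis mult.commute mult.assoc)
  show ?thesis
    using assms(2) unfolding plus_entries_def[of N A]
  proof (elim disjE exE conjE)
    fix a b c d :: int
    assume A: "A $ 1 $ 1 = real_of_int a" "A $ 1 $ 2 = real_of_int b" "A $ 2 $ 1 = real N * real_of_int c" "A $ 2 $ 2 = real_of_int d"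
    show ?thesis using assms(3) unfolding plus_entries_def[of N B]
    proof (elim disjE exE conjE)
      fix a' b' c' d' :: int
      assume B: "B $ 1 $ 1 = real_of_int a'" "B $ 1 $ 2 = real_of_int b'" "B $ 2 $ 1 = real N * real_of_int c'" "B $ 2 $ 2 = real_of_int d'"
      show ?thesis unfolding plus_entries_def
        by (rule disjI1, rule exI[of _ "a * a' + b * (int N * c')"], rule exI[of _ "a * b' + b * d'"],
            rule exI[of _ "c * a' + d * c'"], rule exI[of _ "int N * c * b' + d * d'"])
           (simp add: matrix_mult_2 A B algebra_simps)
    next
      fix a' b' c' d' :: int
      assume B: "B $ 1 $ 1 = sqrt (real N) * real_of_int a'" "B $ 1 $ 2 = real_of_int b' / sqrt (real N)"
        "B $ 2 $ 1 = sqrt (real N) * real_of_int c'" "B $ 2 $ 2 = sqrt (real N) * real_of_int d'"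
      show ?thesis unfolding plus_entries_def
        by (rule disjI2, rule exI[of _ "a * a' + b * c'"], rule exI[of _ "a * b' + int N * b * d'"],
            rule exI[of _ "int N * c * a' + d * c'"], rule exI[of _ "c * b' + d * d'"])
           (use s q q' in \<open>simp add: matrix_mult_2 A B algebra_simps add_divide_distrib\<close>)
    qed
  next
    fix a b c d :: int
    assume A: "A $ 1 $ 1 = sqrt (real N) * real_of_int a" "A $ 1 $ 2 = real_of_int b / sqrt (real N)"
      "A $ 2 $ 1 = sqrt (real N) * real_of_int c" "A $ 2 $ 2 = sqrt (real N) * real_of_int d"
    show ?thesis using assms(3) unfolding plus_entries_def[of N B]
    proof (elim disjE exE conjE)
      fix a' b' c' d' :: int
      assume B: "B $ 1 $ 1 = real_of_int a'" "B $ 1 $ 2 = real_of_int b'" "B $ 2 $ 1 = real N * real_of_int c'" "B $ 2 $ 2 = real_of_int d'"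
      show ?thesis unfolding plus_entries_def
        by (rule disjI2, rule exI[of _ "a * a' + b * c'"], rule exI[of _ "int N * a * b' + b * d'"],
            rule exI[of _ "c * a' + int N * d * c'"], rule exI[of _ "c * b' + d * d'"])
           (use s q q' in \<open>simp add: matrix_mult_2 A B algebra_simps add_divide_distrib\<close>)
    next
      fix a' b' c' d' :: int
      assume B: "B $ 1 $ 1 = sqrt (real N) * real_of_int a'" "B $ 1 $ 2 = real_of_int b' / sqrt (real N)"
        "B $ 2 $ 1 = sqrt (real N) * real_of_int c'" "B $ 2 $ 2 = sqrt (real N) * real_of_int d'"
      show ?thesis unfolding plus_entries_def
        by (rule disjI1, rule exI[of _ "int N * a * a' + b * c'"], rule exI[of _ "a * b' + b * d'"],
            rule exI[of _ "c * a' + d * c'"], rule exI[of _ "c * b' + int N * d * d'"])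
           (use s q q' in \<open>simp add: matrix_mult_2 A B algebra_simps add_divide_distrib\<close>)
    qed
  qed
qed

lemma plus_entries_inv:
  assumes "A \<in> carrier SL2R" "plus_entries N A" shows "plus_entries N (inv\<^bsub>SL2R\<^esub> A)"
  using assms(2) unfolding plus_entries_def[of N A]
proof (elim disjE exE conjE)
  fix a b c d :: int
  assume A: "A $ 1 $ 1 = real_of_int a" "A $ 1 $ 2 = real_of_int b" "A $ 2 $ 1 = real N * real_of_int c" "A $ 2 $ 2 = real_of_int d"
  show ?thesis unfolding plus_entries_def
    by (rule disjI1, rule exI[of _ d], rule exI[of _ "- b"], rule exI[of _ "- c"], rule exI[of _ a])
       (simp add: inv_SL2R[OF assms(1)] A)
next
  fix a b c d :: int
  assume A: "A $ 1 $ 1 = sqrt (real N) * real_of_int a" "A $ 1 $ 2 = real_of_int b / sqrt (real N)"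
    "A $ 2 $ 1 = sqrt (real N) * real_of_int c" "A $ 2 $ 2 = sqrt (real N) * real_of_int d"
  show ?thesis unfolding plus_entries_def
    by (rule disjI2, rule exI[of _ d], rule exI[of _ "- b"], rule exI[of _ "- c"], rule exI[of _ a])
       (simp add: inv_SL2R[OF assms(1)] A)
qed

lemma Gamma0_plus_entries:
  assumes "N > 0" "A \<in> Gamma0_plus N" shows "plus_entries N A"
proof -
  have gen: "plus_entries N B" if "B \<in> insert (fricke N) (Gamma0 N)" for B
  proof (cases "B = fricke N")
    case True
    show ?thesis unfolding plus_entries_def True
      by (rule disjI2, rule exI[of _ 0], rule exI[of _ "-1"], rule exI[of _ 1], rule exI[of _ 0])
         (simp add: fricke_def)
  next
    case False
    then have B: "B \<in> Gamma0 N" using that by simp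
    then have "B $ 1 $ 1 \<in> \<int>" "B $ 1 $ 2 \<in> \<int>" "B $ 2 $ 2 \<in> \<int>" by (auto simp: Gamma0_def SL2Z_def)
    then show ?thesis using B unfolding plus_entries_def Gamma0_def by (auto elim!: Ints_cases)
  qed
  show ?thesis using assms(2) unfolding Gamma0_plus_def
  proof (induction rule: generate.induct)
    case one
    show ?case unfolding plus_entries_def
      by (rule disjI1, rule exI[of _ 1], rule exI[of _ 0], rule exI[of _ 0], rule exI[of _ 1])
         (simp add: SL2R_def mat_def)
  next
    case (incl h) then show ?case using gen by blast
  next
    case (inv h)
    then have "h \<in> carrier SL2R" using assms(1) fricke_in_SL2R by (auto simp: Gamma0_def SL2Z_def)
    then show ?case using plus_entries_inv gen inv by blast
  next
    case (eng h1 h2)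
    then show ?case using plus_entries_mult[OF assms(1)] by (simp add: SL2R_def)
  qed
qed

text \<open>All that discreteness needs from the shape of the entries: in both cosets, each entry
  lies in one fixed discrete set of reals.\<close>

lemma plus_entries_square_int:
  assumes "N > 0" "plus_entries N A" shows "real N * (A $ i $ j)\<^sup>2 \<in> \<int>"
proof -
  have "real N * (A $ 1 $ 1)\<^sup>2 \<in> \<int> \<and> real N * (A $ 1 $ 2)\<^sup>2 \<in> \<int> \<and> real N * (A $ 2 $ 1)\<^sup>2 \<in> \<int> \<and> real N * (A $ 2 $ 2)\<^sup>2 \<in> \<int>"
    using assms(2) unfolding plus_entries_def
    by (elim disjE exE conjE) (use assms(1) in \<open>simp_all add: power_mult_distrib power_divide\<close>)
  then show ?thesis using exhaust_2[of i] exhaust_2[of j] by auto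
qed

lemma finite_bounded_square_int:
  assumes "n > 0" shows "finite {x :: real. \<bar>x\<bar> \<le> B \<and> n * x\<^sup>2 \<in> \<int>}"
proof (rule finite_subset)
  let ?M = "(\<lambda>m::int. sqrt (of_int m / n)) ` {0..\<lfloor>n * B\<^sup>2\<rfloor>}"
  show "finite (?M \<union> uminus ` ?M)" by simp
  show "{x. \<bar>x\<bar> \<le> B \<and> n * x\<^sup>2 \<in> \<int>} \<subseteq> ?M \<union> uminus ` ?M"
  proof
    fix x assume "x \<in> {x. \<bar>x\<bar> \<le> B \<and> n * x\<^sup>2 \<in> \<int>}"
    then have x: "\<bar>x\<bar> \<le> B" and "n * x\<^sup>2 \<in> \<int>" by auto
    then obtain m :: int where m: "n * x\<^sup>2 = of_int m" by (auto elim: Ints_cases)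
    have "x\<^sup>2 \<le> B\<^sup>2" using x by (metis abs_ge_zero power2_abs power_mono)
    then have "of_int m \<le> n * B\<^sup>2" using m assms by (metis mult_left_mono less_imp_le)
    moreover have "0 \<le> m" using m assms by (metis mult_nonneg_nonneg zero_le_power2 less_imp_le of_int_0_le_iff)
    ultimately have "m \<in> {0..\<lfloor>n * B\<^sup>2\<rfloor>}" by (simp add: le_floor_iff)
    moreover have "\<bar>x\<bar> = sqrt (of_int m / n)" using m assms by (simp add: flip: m)
    ultimately have "\<bar>x\<bar> \<in> ?M" by blast
    then show "x \<in> ?M \<union> uminus ` ?M" by (cases "x \<ge> 0") (simp_all, metis imageI minus_minus)
  qed
qed

text \<open>The imaginary part is bounded below on \<open>K\<close>, so the automorphy factor is
  bounded, and with it the lower row of the matrix. The numerator is the point of \<open>K\<close>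
  times this factor, which bounds the upper row. Bounded entries from a discrete set leave finitely
  many matrices.\<close>

lemma finite_orbit_Int_compact:
  assumes N: "N > 0" and "Im z > 0" and K: "compact K" "K \<subseteq> upper_half_plane"
  shows "finite ((\<lambda>A. moeb A z) ` Gamma0_plus N \<inter> K)"
proof (cases "K = {}")
  case False
  obtain R where R: "\<And>w. w \<in> K \<Longrightarrow> cmod w \<le> R" using K(1) by (metis bounded_iff compact_imp_bounded)
  have "compact (Im ` K)" using K(1) by (intro compact_continuous_image continuous_intros)
  then obtain e where e: "e \<in> Im ` K" "\<And>w. w \<in> K \<Longrightarrow> e \<le> Im w"
    using compact_attains_inf[of "Im ` K"] False by auto
  then have "e > 0" using K(2) by (auto simp: upper_half_plane_def)
  define y where "y = Im z"
  define M where "M = sqrt (y / e)"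
  define B where "B = max (M / y + M / y * cmod z + M) (R * M / y + R * M / y * cmod z + R * M)"
  define F where "F = {x :: real. \<bar>x\<bar> \<le> B \<and> real N * x\<^sup>2 \<in> \<int>}"
  have y: "y > 0" and M: "M > 0" using assms \<open>e > 0\<close> by (auto simp: y_def M_def)
  have "R \<ge> 0" using R False by (metis all_not_in_conv norm_ge_zero order_trans)
  \<comment> \<open>The imaginary part of \<open>c z + d\<close> isolates \<open>c\<close>; then
    \<open>d\<close> follows by the triangle inequality. Used with \<open>S = M\<close> for the
    lower row and \<open>S = R * M\<close> for the upper row, whence the two arguments of the
    maximum in \<open>B\<close>.\<close>
  have lin: "\<bar>c\<bar> \<le> S / y \<and> \<bar>d\<bar> \<le> S + S / y * cmod z" if "cmod (of_real c * z + of_real d) \<le> S" for c d S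
  proof -
    have "\<bar>c * y\<bar> \<le> S" using abs_Im_le_cmod[of "of_real c * z + of_real d"] that by (simp add: y_def)
    then have c: "\<bar>c\<bar> \<le> S / y" using y by (simp add: abs_mult pos_le_divide_eq)
    have "\<bar>d\<bar> = cmod ((of_real c * z + of_real d) - of_real c * z)" by simp
    also have "\<dots> \<le> S + \<bar>c\<bar> * cmod z"
      using norm_triangle_ineq4[of "of_real c * z + of_real d" "of_real c * z"] that by (simp add: norm_mult)
    also have "\<dots> \<le> S + S / y * cmod z" using c by (intro add_left_mono mult_right_mono) auto
    finally show ?thesis using c by simp
  qed
  have "(\<lambda>A. moeb A z) ` Gamma0_plus N \<inter> K \<subseteq>
        (\<lambda>(a,b,c,d). (of_real a * z + of_real b) / (of_real c * z + of_real d)) ` (F \<times> F \<times> F \<times> F)"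
  proof
    fix w assume "w \<in> (\<lambda>A. moeb A z) ` Gamma0_plus N \<inter> K"
    then obtain A where A: "A \<in> Gamma0_plus N" and w: "w = moeb A z" "w \<in> K" by auto
    have AS: "A \<in> carrier SL2R" using A Gamma0_plus_subset_SL2R[OF N] by auto
    let ?j = "aut_factor A z"
    have j0: "?j \<noteq> 0" using aut_factor_nonzero AS assms by auto
    have "e \<le> y / (cmod ?j)\<^sup>2" using e(2)[OF w(2)] Im_moeb[OF AS assms(2)] w y_def by simp
    then have "(cmod ?j)\<^sup>2 \<le> y / e" using \<open>e > 0\<close> j0 by (simp add: field_simps)
    then have j: "cmod ?j \<le> M" unfolding M_def by (rule real_le_rsqrt)
    have "of_real (A $ 1 $ 1) * z + of_real (A $ 1 $ 2) = w * ?j" using j0 w by (simp add: moeb_def)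
    then have ab: "cmod (of_real (A $ 1 $ 1) * z + of_real (A $ 1 $ 2)) \<le> R * M"
      using R[OF w(2)] j \<open>R \<ge> 0\<close> by (simp add: norm_mult mult_mono)
    have nn: "M / y \<ge> 0" "M / y * cmod z \<ge> 0" "R * M / y \<ge> 0" "R * M / y * cmod z \<ge> 0" "R * M \<ge> 0"
      using y M \<open>R \<ge> 0\<close> by auto
    have "\<bar>A $ 2 $ 1\<bar> \<le> B" "\<bar>A $ 2 $ 2\<bar> \<le> B"
      using lin[OF j[unfolded aut_factor_def]] nn M unfolding B_def by linarith+
    moreover have "\<bar>A $ 1 $ 1\<bar> \<le> B" "\<bar>A $ 1 $ 2\<bar> \<le> B"
      using lin[OF ab] nn M unfolding B_def by linarith+
    ultimately have "A $ 1 $ 1 \<in> F" "A $ 1 $ 2 \<in> F" "A $ 2 $ 1 \<in> F" "A $ 2 $ 2 \<in> F"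
      using plus_entries_square_int[OF N Gamma0_plus_entries[OF N A]] by (auto simp: F_def)
    then show "w \<in> (\<lambda>(a,b,c,d). (of_real a * z + of_real b) / (of_real c * z + of_real d)) ` (F \<times> F \<times> F \<times> F)"
      unfolding w moeb_def aut_factor_def by force
  qed
  moreover have "finite F" unfolding F_def using finite_bounded_square_int[of "real N"] N by simp
  ultimately show ?thesis by (meson finite_SigmaI finite_imageI finite_subset)
qed simp

section \<open>Holomorphic self-maps of the upper half-plane\<close>

lemma open_upper_half_plane: "open upper_half_plane"
  unfolding upper_half_plane_def by (rule open_halfspace_Im_gt)

lemma convex_upper_half_plane: "convex upper_half_plane"
  unfolding upper_half_plane_def by (rule convex_halfspace_Im_gt)

lemma connected_upper_half_plane: "connected upper_half_plane"
  by (rule convex_connected[OF convex_upper_half_plane])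

text \<open>Otherwise both factors would be nonzero throughout a punctured neighbourhood of
  \<open>z\<close>. This cancels \<open>f\<close> from identities, also at the zeros of
  \<open>f\<close>.\<close>

lemma holomorphic_mult_eq_0:
  assumes "f holomorphic_on S" "g holomorphic_on S" "open S" "connected S"
    and b: "b \<in> S" "f b \<noteq> 0" and zero: "\<And>z. z \<in> S \<Longrightarrow> g z * f z = 0" and "z \<in> S"
  shows "g z = 0"
proof (rule ccontr)
  assume "g z \<noteq> 0"
  then have "\<forall>\<^sub>F w in at z. g w \<noteq> 0 \<and> w \<in> S"
    using non_zero_neighbour_alt[of g S z z] assms by auto
  moreover have "\<forall>\<^sub>F w in at z. f w \<noteq> 0 \<and> w \<in> S"
    using non_zero_neighbour_alt[of f S z b] assms by auto
  ultimately have "\<forall>\<^sub>F w in at z. False"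
    by eventually_elim (use zero in force)
  then show False by simp
qed

text \<open>The zeros of \<open>v\<close> are isolated and \<open>u / v\<close> is bounded by 1
  around them, so they are removable singularities; the bound and the product identity pass to the
  limit.\<close>

lemma bounded_quotient_extends:
  fixes u v :: "complex \<Rightarrow> complex"
  assumes u: "u holomorphic_on S" and v: "v holomorphic_on S" and S: "open S" "connected S"
    and b: "b \<in> S" "v b \<noteq> 0" and le: "\<And>z. z \<in> S \<Longrightarrow> cmod (u z) \<le> cmod (v z)"
  obtains g where "g holomorphic_on S" "\<And>z. z \<in> S \<Longrightarrow> u z = g z * v z" "\<And>z. z \<in> S \<Longrightarrow> cmod (g z) \<le> 1"
proof -
  define h where "h z = u z / v z" for z
  define g where "g = remove_sings h"
  have hol: "h holomorphic_on {z \<in> S. v z \<noteq> 0}"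
    unfolding h_def by (intro holomorphic_on_divide holomorphic_on_subset[OF u] holomorphic_on_subset[OF v]) auto
  have "{z \<in> S. v z \<noteq> 0} = S \<inter> v -` (- {0})" by auto
  then have opn: "open {z \<in> S. v z \<noteq> 0}"
    using continuous_open_preimage[OF holomorphic_on_imp_continuous_on[OF v] S(1), of "- {0}"]
    by (simp add: open_Compl)
  have eq: "g z = h z" if "z \<in> S" "v z \<noteq> 0" for z
    unfolding g_def by (intro remove_sings_at_analytic, unfold analytic_at) (use that hol opn in blast)
  have nz: "\<forall>\<^sub>F w in at z. v w \<noteq> 0 \<and> w \<in> S" if "z \<in> S" for z
    using non_zero_neighbour_alt[OF v S that b] .
  have loc: "g analytic_on {z} \<and> cmod (g z) \<le> 1 \<and> u z = g z * v z" if z: "z \<in> S" for z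
  proof -
    obtain r where r: "r > 0" "\<And>w. w \<noteq> z \<Longrightarrow> dist w z < r \<Longrightarrow> v w \<noteq> 0 \<and> w \<in> S"
      using nz[OF z] unfolding eventually_at by auto
    have hr: "h holomorphic_on (ball z r - {z})"
      by (rule holomorphic_on_subset[OF hol]) (use r(2) in \<open>simp add: subset_iff dist_commute\<close>)
    have iso: "isolated_singularity_at h z"
      unfolding isolated_singularity_at_def
      using r(1) hr by (intro exI[of _ r]) (simp add: analytic_on_open open_delete)
    have bd: "\<forall>\<^sub>F w in at z. cmod (h w) \<le> 1"
      using nz[OF z] by eventually_elim (use le in \<open>auto simp: h_def norm_divide divide_le_eq_1\<close>)
    have "z \<in> interior (ball z r)" using r by simp
    from holomorphic_on_extend_bounded[OF hr this] bd
    obtain k where k: "k holomorphic_on ball z r" "\<And>w. w \<in> ball z r - {z} \<Longrightarrow> k w = h w"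
      by blast
    have ev: "\<forall>\<^sub>F w in at z. k w = h w"
      unfolding eventually_at using r(1) k(2) by (intro exI[of _ r]) (simp add: dist_commute)
    have "continuous_on (ball z r) k" using k(1) by (rule holomorphic_on_imp_continuous_on)
    then have "isCont k z" using r(1) by (simp add: continuous_on_eq_continuous_at)
    then have "(k \<longlongrightarrow> k z) (at z)" by (simp add: isCont_def)
    then have lim: "(h \<longlongrightarrow> k z) (at z)" by (rule Lim_transform_eventually[OF _ ev])
    have ana: "g analytic_on {z}" unfolding g_def by (rule remove_sings_analytic_at[OF iso lim])
    have gz: "g z = k z" unfolding g_def by (rule remove_sings_eqI[OF lim])
    have "cmod (k z) \<le> 1"
      by (rule tendsto_upperbound[OF tendsto_norm[OF lim] bd]) simp
    moreover have "u z = k z * v z"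
    proof (rule tendsto_unique[of "at z"])
      have cont: "isCont u z" "isCont v z"
        using holomorphic_on_imp_continuous_on[OF u] holomorphic_on_imp_continuous_on[OF v] S(1) z
        by (simp_all add: continuous_on_eq_continuous_at)
      then show "(u \<longlongrightarrow> u z) (at z)" by (simp add: isCont_def)
      have "((\<lambda>w. h w * v w) \<longlongrightarrow> k z * v z) (at z)" using lim cont(2) by (intro tendsto_mult) (auto simp: isCont_def)
      moreover have "\<forall>\<^sub>F w in at z. h w * v w = u w"
        using nz[OF z] by eventually_elim (simp add: h_def)
      ultimately show "(u \<longlongrightarrow> k z * v z) (at z)" by (rule Lim_transform_eventually)
    qed simp
    ultimately show ?thesis using ana gz by simp
  qed
  have "g analytic_on S" using loc by (subst analytic_on_analytic_at) blast
  then have "g holomorphic_on S" by (rule analytic_imp_holomorphic)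
  then show ?thesis using that[of g] loc by simp
qed

lemma Cayley_less:
  assumes "Im h > 0" shows "cmod (h - \<i>) < cmod (h + \<i>)"
proof (rule power2_less_imp_less)
  show "(cmod (h - \<i>))\<^sup>2 < (cmod (h + \<i>))\<^sup>2"
    using assms by (simp add: cmod_power2) (simp add: power2_eq_square algebra_simps)
qed simp

text \<open>The quotient \<open>u / v\<close> is the Cayley transform of \<open>p / f\<close>, hence
  bounded by 1 and extendable. A pole of \<open>p / f\<close> would give it the value 1, which the
  maximum principle forbids because the modulus is below 1 at \<open>b\<close>. So undoing the
  transform is safe everywhere.\<close>

lemma upper_half_plane_quotient_extends:
  assumes p: "p holomorphic_on S" and f: "f holomorphic_on S" and S: "open S" "connected S"
    and b: "b \<in> S" "f b \<noteq> 0" and pos: "\<And>z. z \<in> S \<Longrightarrow> f z \<noteq> 0 \<Longrightarrow> Im (p z / f z) > 0"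
  obtains G where "G holomorphic_on S" "\<And>z. z \<in> S \<Longrightarrow> Im (G z) > 0" "\<And>z. z \<in> S \<Longrightarrow> p z = G z * f z"
proof -
  define u where "u z = p z - \<i> * f z" for z
  define v where "v z = p z + \<i> * f z" for z
  have less: "cmod (u z) < cmod (v z)" if "z \<in> S" "f z \<noteq> 0" for z
  proof -
    have "u z = (p z / f z - \<i>) * f z" "v z = (p z / f z + \<i>) * f z"
      using that by (simp_all add: u_def v_def field_simps)
    then show ?thesis
      using Cayley_less[OF pos[OF that]] that by (simp add: norm_mult)
  qed
  have le: "cmod (u z) \<le> cmod (v z)" if "z \<in> S" for z
    using less[OF that] by (cases "f z = 0") (auto simp: u_def v_def)
  have hol: "u holomorphic_on S" "v holomorphic_on S"
    unfolding u_def v_def by (intro holomorphic_intros p f)+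
  have "v b \<noteq> 0" using less[OF b] by auto
  from bounded_quotient_extends[OF hol S b(1) this le] obtain g where
    g: "g holomorphic_on S" "\<And>z. z \<in> S \<Longrightarrow> u z = g z * v z" "\<And>z. z \<in> S \<Longrightarrow> cmod (g z) \<le> 1"
    by blast
  have g1: "cmod (g z) < 1" if z: "z \<in> S" for z
  proof (rule ccontr)
    assume "\<not> cmod (g z) < 1"
    then have "cmod (g z) = 1" using g(3)[OF z] by simp
    then have "g constant_on S"
      using maximum_modulus_principle[OF g(1) S S(1) _ z] g(3) by auto
    then have "cmod (g b) = 1" using \<open>cmod (g z) = 1\<close> z b(1) by (auto simp: constant_on_def)
    then have "cmod (u b) = cmod (v b)" using g(2)[OF b(1)] by (simp add: norm_mult)
    then show False using less[OF b] by simp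
  qed
  then have ne: "1 - g z \<noteq> 0" if "z \<in> S" for z using that by force
  define G where "G z = \<i> * (1 + g z) / (1 - g z)" for z
  show ?thesis
  proof
    show "G holomorphic_on S" unfolding G_def using ne g(1) by (intro holomorphic_intros) auto
    show "Im (G z) > 0" if z: "z \<in> S" for z
    proof -
      have "Im (G z) * (cmod (1 - g z))\<^sup>2 = 1 - (cmod (g z))\<^sup>2"
        using ne[OF z] unfolding G_def complex_div_cnj[of _ "1 - g z"]
        by (simp add: Im_divide_of_real flip: of_real_power)
           (simp add: cmod_power2, simp add: power2_eq_square algebra_simps)
      moreover have "(cmod (g z))\<^sup>2 < 1" using g1[OF z] by (simp add: power_less_one_iff)
      ultimately have "Im (G z) * (cmod (1 - g z))\<^sup>2 > 0" by simp
      then show ?thesis by (simp add: zero_less_mult_iff)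
    qed
    show "p z = G z * f z" if z: "z \<in> S" for z
    proof -
      have "p z - \<i> * f z = g z * (p z + \<i> * f z)" using g(2)[OF z] by (simp add: u_def v_def)
      then have "p z * (1 - g z) = \<i> * (1 + g z) * f z" by (simp add: algebra_simps)
      then show ?thesis using ne[OF z] by (simp add: G_def field_simps)
    qed
  qed
qed

text \<open>The Schwarz lemma moved from the disc by \<psi>, which sends \<open>a\<close> to 0 and
  has inverse \<kappa>. The condition on \<open>b\<close> is its equality case: \<open>G\<close>
  preserves the hyperbolic distance from \<open>a\<close> to \<open>b\<close>. The constant \<alpha>
  is the resulting rotation.\<close>

lemma upper_half_plane_Schwarz:
  assumes G: "G holomorphic_on upper_half_plane" "\<And>z. z \<in> upper_half_plane \<Longrightarrow> G z \<in> upper_half_plane"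
    and a: "a \<in> upper_half_plane" "G a = a"
    and b: "b \<in> upper_half_plane" "b \<noteq> a"
      "cmod ((G b - a) / (G b - cnj a)) = cmod ((b - a) / (b - cnj a))"
  obtains \<alpha> where "\<And>z. z \<in> upper_half_plane \<Longrightarrow> (G z - a) / (G z - cnj a) = \<alpha> * ((z - a) / (z - cnj a))"
proof -
  define \<psi> where "\<psi> z = (z - a) / (z - cnj a)" for z
  define \<kappa> where "\<kappa> w = (a - cnj a * w) / (1 - w)" for w
  have Ima: "Im a > 0" using a by (simp add: upper_half_plane_def)
  have ne: "z - cnj a \<noteq> 0" if "z \<in> upper_half_plane" for z
    using that Ima by (auto simp: upper_half_plane_def complex_eq_iff)
  have aa: "a - cnj a \<noteq> 0" by (rule ne[OF a(1)])
  have \<psi>1: "cmod (\<psi> z) < 1" if z: "z \<in> upper_half_plane" for z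
  proof -
    have "(cmod (z - a))\<^sup>2 < (cmod (z - cnj a))\<^sup>2"
      using z Ima by (simp add: cmod_power2 upper_half_plane_def) (simp add: power2_eq_square algebra_simps)
    then have "cmod (z - a) < cmod (z - cnj a)" by (rule power2_less_imp_less) simp
    then show ?thesis using ne[OF z] by (simp add: \<psi>_def norm_divide)
  qed
  have w1: "1 - w \<noteq> 0" if "cmod w < 1" for w using that by force
  have \<kappa>H: "\<kappa> w \<in> upper_half_plane" if w: "cmod w < 1" for w
  proof -
    have "Im (\<kappa> w) * (cmod (1 - w))\<^sup>2 = Im a * (1 - (cmod w)\<^sup>2)"
      using w1[OF w] unfolding \<kappa>_def complex_div_cnj[of _ "1 - w"]
      by (simp add: Im_divide_of_real flip: of_real_power)
         (simp add: cmod_power2, simp add: power2_eq_square algebra_simps)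
    moreover have "(cmod w)\<^sup>2 < 1" using w by (simp add: power_less_one_iff)
    ultimately have "Im (\<kappa> w) * (cmod (1 - w))\<^sup>2 > 0" using Ima by simp
    then show ?thesis by (simp add: zero_less_mult_iff upper_half_plane_def)
  qed
  have \<kappa>\<psi>: "\<kappa> (\<psi> z) = z" if z: "z \<in> upper_half_plane" for z
  proof -
    have "1 - \<psi> z = (a - cnj a) / (z - cnj a)" using ne[OF z] by (simp add: \<psi>_def field_simps)
    moreover have "a - cnj a * \<psi> z = z * (a - cnj a) / (z - cnj a)"
      using ne[OF z] by (simp add: \<psi>_def field_simps)
    ultimately show ?thesis using ne[OF z] aa by (simp add: \<kappa>_def)
  qed
  have \<psi>\<kappa>: "\<psi> (\<kappa> w) = w" if w: "cmod w < 1" for w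
  proof -
    have "\<kappa> w - a = w * (a - cnj a) / (1 - w)" using w1[OF w] by (simp add: \<kappa>_def field_simps)
    moreover have "\<kappa> w - cnj a = (a - cnj a) / (1 - w)" using w1[OF w] by (simp add: \<kappa>_def field_simps)
    ultimately show ?thesis using w1[OF w] aa by (simp add: \<psi>_def)
  qed
  define F where "F = \<psi> \<circ> (G \<circ> \<kappa>)"
  have hol\<kappa>: "\<kappa> holomorphic_on ball 0 1" unfolding \<kappa>_def using w1 by (intro holomorphic_intros) auto
  have hol\<psi>: "\<psi> holomorphic_on upper_half_plane" unfolding \<psi>_def using ne by (intro holomorphic_intros) auto
  have holF: "F holomorphic_on ball 0 1"
    unfolding F_def
    by (intro holomorphic_on_compose_gen[OF _ hol\<psi>] holomorphic_on_compose_gen[OF hol\<kappa> G(1)])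
       (use \<kappa>H G(2) in auto)
  have F0: "F 0 = 0" using a(2) by (simp add: F_def \<kappa>_def \<psi>_def)
  have F1: "cmod (F w) < 1" if "cmod w < 1" for w
    using \<psi>1 G(2) \<kappa>H[OF that] by (simp add: F_def)
  have F\<psi>: "F (\<psi> z) = \<psi> (G z)" if "z \<in> upper_half_plane" for z
    using \<kappa>\<psi>[OF that] by (simp add: F_def)
  have "\<psi> b \<noteq> 0" using b ne by (simp add: \<psi>_def)
  moreover have "cmod (F (\<psi> b)) = cmod (\<psi> b)" using F\<psi>[OF b(1)] b(3) by (simp add: \<psi>_def)
  ultimately obtain \<alpha> where \<alpha>: "\<And>w. cmod w < 1 \<Longrightarrow> F w = \<alpha> * w"
    using Schwarz_Lemma(3)[OF holF F0 F1, of 0] \<psi>1[OF b(1)] by auto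
  show ?thesis
    by (rule that[of \<alpha>]) (use \<alpha>[OF \<psi>1] F\<psi> in \<open>auto simp: \<psi>_def\<close>)
qed

text \<open>Serves the countability of the zeros of a nonconstant holomorphic function.\<close>

lemma fsigma_upper_half_plane: "fsigma upper_half_plane"
proof -
  have "upper_half_plane = (\<Union>n. {z. Im z \<ge> 1 / real (Suc n)})"
  proof (intro equalityI subsetI)
    fix z assume "z \<in> upper_half_plane"
    then obtain n where "inverse (real (Suc n)) < Im z"
      using reals_Archimedean[of "Im z"] by (auto simp: upper_half_plane_def)
    then show "z \<in> (\<Union>n. {z. Im z \<ge> 1 / real (Suc n)})"
      by (auto simp: inverse_eq_divide intro!: exI[of _ n])
  next
    fix z assume "z \<in> (\<Union>n. {z. Im z \<ge> 1 / real (Suc n)})"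
    then obtain n where "1 / real (Suc n) \<le> Im z" by auto
    moreover have "0 < 1 / real (Suc n)" by simp
    ultimately have "0 < Im z" by (rule less_le_trans[rotated])
    then show "z \<in> upper_half_plane" unfolding upper_half_plane_def by simp
  qed
  then show ?thesis using fsigma.intros[of "\<lambda>n. {z. Im z \<ge> 1 / real (Suc n)}"]
    by (simp add: closed_halfspace_Im_ge)
qed

text \<open>The hypotheses on \<open>p\<close> and \<open>f\<close> express the equivariance of
  \<open>h = p / f\<close> without division, and the point \<open>a\<close> witnesses that
  \<open>h\<close> is not the identity.\<close>

lemma quotient_real_somewhere:
  fixes N :: real and p f J :: "complex \<Rightarrow> complex"
  assumes N: "N > 0"
    and p: "p holomorphic_on upper_half_plane" and f: "f holomorphic_on upper_half_plane"
    and T: "\<And>z. z \<in> upper_half_plane \<Longrightarrow> f (z + 1) = f z"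
      "\<And>z. z \<in> upper_half_plane \<Longrightarrow> p (z + 1) = p z + f z"
    and J: "\<And>z. z \<in> upper_half_plane \<Longrightarrow> J z \<noteq> 0"
    and W: "\<And>z. z \<in> upper_half_plane \<Longrightarrow> f (- 1 / (of_real N * z)) = J z * of_real N * p z"
      "\<And>z. z \<in> upper_half_plane \<Longrightarrow> p (- 1 / (of_real N * z)) = - J z * f z"
    and a: "a \<in> upper_half_plane" "p a \<noteq> a * f a"
  shows "\<exists>z\<in>upper_half_plane. f z \<noteq> 0 \<and> Im (p z / f z) = 0"
proof (rule ccontr)
  let ?H = upper_half_plane
  note top = open_upper_half_plane connected_upper_half_plane
  assume "\<not> ?thesis"
  then have nonreal: "Im (p z / f z) \<noteq> 0" if "z \<in> ?H" "f z \<noteq> 0" for z using that by blast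
  \<comment> \<open>If \<open>f\<close> vanished identically, the law of the involution would give
    \<open>p a = 0\<close> and contradict the choice of \<open>a\<close>.\<close>
  obtain b where b: "b \<in> ?H" "f b \<noteq> 0"
  proof (rule ccontr)
    assume "\<not> thesis"
    then have f0: "f z = 0" if "z \<in> ?H" for z using that \<open>\<And>b. \<lbrakk>b \<in> ?H; f b \<noteq> 0\<rbrakk> \<Longrightarrow> thesis\<close> by blast
    have "- 1 / (of_real N * a) \<in> ?H"
      using a(1) N by (simp add: upper_half_plane_def Im_divide divide_neg_pos sum_power2_gt_zero_iff)
    from f0[OF this] have "p a = 0" using W(1)[OF a(1)] J[OF a(1)] N by simp
    then show False using a f0 by simp
  qed
  \<comment> \<open>Removing the countably many zeros of \<open>f\<close> leaves a connected set, on
    which \<open>Im (p / f)\<close> is continuous and never 0, so its sign is constant.\<close>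
  have "\<exists>s\<in>{1, -1}. \<forall>z\<in>?H. f z \<noteq> 0 \<longrightarrow> Im (of_real s * p z / f z) > 0"
  proof -
    have count: "countable {z \<in> ?H. f z = 0}"
    proof (cases "f constant_on ?H")
      case True
      then have "f z \<noteq> 0" if "z \<in> ?H" for z using b that unfolding constant_on_def by metis
      then have "{z \<in> ?H. f z = 0} = {}" by blast
      then show ?thesis by (metis countable_empty)
    next
      case False
      then show ?thesis
        using holomorphic_countable_zeros[OF f top fsigma_upper_half_plane] by blast
    qed
    have "connected (?H - {z \<in> ?H. f z = 0})"
      using connected_open_diff_countable[OF _ top count] by simp
    moreover have "?H - {z \<in> ?H. f z = 0} = {z \<in> ?H. f z \<noteq> 0}" by auto
    ultimately have "connected {z \<in> ?H. f z \<noteq> 0}" by simp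
    moreover have "continuous_on {z \<in> ?H. f z \<noteq> 0} (\<lambda>z. Im (p z / f z))"
      by (intro continuous_intros holomorphic_on_imp_continuous_on holomorphic_on_subset[OF p]
            holomorphic_on_subset[OF f]) auto
    ultimately have "connected ((\<lambda>z. Im (p z / f z)) ` {z \<in> ?H. f z \<noteq> 0})"
      using connected_continuous_image by blast
    then have iv: "is_interval ((\<lambda>z. Im (p z / f z)) ` {z \<in> ?H. f z \<noteq> 0})"
      by (simp add: is_interval_connected_1)
    have nz: "0 \<notin> (\<lambda>z. Im (p z / f z)) ` {z \<in> ?H. f z \<noteq> 0}" using nonreal by force
    have same: "\<not> (Im (p z / f z) < 0 \<and> Im (p w / f w) > 0)"
      if "z \<in> ?H" "w \<in> ?H" "f z \<noteq> 0" "f w \<noteq> 0" for z w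
    proof
      let ?A = "(\<lambda>z. Im (p z / f z)) ` {z \<in> ?H. f z \<noteq> 0}"
      assume neg: "Im (p z / f z) < 0 \<and> Im (p w / f w) > 0"
      have "Im (p z / f z) \<in> ?A" "Im (p w / f w) \<in> ?A" using that by blast+
      then have "0 \<in> ?A" using mem_is_interval_1_I[OF iv, of "Im (p z / f z)" "Im (p w / f w)" 0] neg by linarith
      then show False using nz by blast
    qed
    show ?thesis
    proof (cases "Im (p b / f b) > 0")
      case True
      have "Im (of_real 1 * p z / f z) > 0" if "z \<in> ?H" "f z \<noteq> 0" for z
        using same[OF that(1) b(1) that(2) b(2)] True nonreal[OF that] by simp
      then show ?thesis by blast
    next
      case False
      then have "Im (p b / f b) < 0" using nonreal[OF b] by simp
      then have "Im (of_real (-1) * p z / f z) > 0" if "z \<in> ?H" "f z \<noteq> 0" for z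
        using same[OF b(1) that(1) b(2) that(2)] nonreal[OF that] by simp
      then show ?thesis by blast
    qed
  qed
  then obtain s :: real where s: "s = 1 \<or> s = -1"
    and pos: "\<And>z. z \<in> ?H \<Longrightarrow> f z \<noteq> 0 \<Longrightarrow> Im (of_real s * p z / f z) > 0" by blast
  have "(\<lambda>z. of_real s * p z) holomorphic_on ?H" by (intro holomorphic_intros p)
  from upper_half_plane_quotient_extends[OF this f top b pos]
  obtain G where G: "G holomorphic_on ?H" "\<And>z. z \<in> ?H \<Longrightarrow> Im (G z) > 0"
    "\<And>z. z \<in> ?H \<Longrightarrow> of_real s * p z = G z * f z" by blast
  \<comment> \<open>\<open>G\<close> extends \<open>s * p / f\<close>, so the translation by 1
    becomes one by \<open>s\<close>. The law is checked after multiplication by \<open>f\<close>,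
    which is then cancelled.\<close>
  have GT: "G (z + 1) = G z + of_real s" if z: "z \<in> ?H" for z
  proof -
    have T1: "(\<lambda>z. z + 1) ` ?H \<subseteq> ?H" by (auto simp: upper_half_plane_def)
    have hol: "(\<lambda>z. G (z + 1) - G z - of_real s) holomorphic_on ?H"
      using holomorphic_on_compose_gen[OF holomorphic_on_add[OF holomorphic_on_ident holomorphic_on_const] G(1) T1] G(1)
      by (intro holomorphic_intros) (simp_all add: o_def)
    have "(G (z + 1) - G z - of_real s) * f z = 0" if "z \<in> ?H" for z
    proof -
      have "z + 1 \<in> ?H" using that T1 by blast
      from G(3)[OF this] G(3)[OF that] T[OF that] show ?thesis by (simp add: algebra_simps)
    qed
    from holomorphic_mult_eq_0[OF f hol top b this z] show ?thesis by (simp add: algebra_simps)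
  qed
  \<comment> \<open>Here the sign occurs twice, and \<open>s * s = 1\<close> removes it.\<close>
  have GW: "of_real N * G (- 1 / (of_real N * z)) * G z = -1" if z: "z \<in> ?H" for z
  proof -
    have W1: "(\<lambda>z. - 1 / (of_real N * z)) ` ?H \<subseteq> ?H"
      using N by (auto simp: upper_half_plane_def Im_divide divide_neg_pos sum_power2_gt_zero_iff)
    have z0: "z \<noteq> 0" if "z \<in> ?H" for z using that by (auto simp: upper_half_plane_def)
    have "(\<lambda>z. - 1 / (of_real N * z)) holomorphic_on ?H" using N z0 by (intro holomorphic_intros) auto
    from holomorphic_on_compose_gen[OF this G(1) W1] G(1)
    have hol: "(\<lambda>z. of_real N * G (- 1 / (of_real N * z)) * G z + 1) holomorphic_on ?H"
      by (intro holomorphic_intros) (auto simp: o_def)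
    have "(of_real N * G (- 1 / (of_real N * z)) * G z + 1) * f z = 0" if "z \<in> ?H" for z
    proof -
      have "- 1 / (of_real N * z) \<in> ?H" using that W1 by blast
      from G(3)[OF this] have eq: "of_real s * (- J z * f z) = G (- 1 / (of_real N * z)) * (J z * of_real N * p z)"
        using W[OF that] by simp
      have ss: "of_real s * of_real s = (1 :: complex)" using s by auto
      have "- J z * f z = of_real s * (of_real s * (- J z * f z))" using ss by (simp flip: mult.assoc)
      also have "\<dots> = G (- 1 / (of_real N * z)) * J z * of_real N * (G z * f z)"
        unfolding eq G(3)[OF that, symmetric] by (simp only: mult_ac)
      finally have "J z * ((of_real N * G (- 1 / (of_real N * z)) * G z + 1) * f z) = J z * f z + - J z * f z"
        by (simp only: distrib_left distrib_right mult_ac mult_1_left mult_1_right add_ac)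
      then have "J z * ((of_real N * G (- 1 / (of_real N * z)) * G z + 1) * f z) = 0" by simp
      then show ?thesis using J[OF that] by simp
    qed
    from holomorphic_mult_eq_0[OF f hol top b this z] show ?thesis by (simp add: eq_neg_iff_add_eq_0)
  qed
  define y where "y = 1 / sqrt N"
  \<comment> \<open>The fixed point of the involution. There \<open>GW\<close> gives
    \<open>N * (G t)\<^sup>2 = -1\<close>, whose only root in the upper half-plane is
    \<open>t\<close>.\<close>
  define t where "t = \<i> * of_real y"
  have y: "y > 0" "y * y * N = 1" using N by (auto simp: y_def field_simps)
  have tH: "t \<in> ?H" using y by (simp add: t_def upper_half_plane_def)
  have tt: "of_real N * t * t = -1" using y(2) by (simp add: t_def algebra_simps flip: of_real_mult)
  have tfix: "- 1 / (of_real N * t) = t" 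
  proof -
    have "t \<noteq> 0" using tH by (auto simp: upper_half_plane_def)
    then have "of_real N * t * t / (of_real N * t) = t" using N by simp
    then show ?thesis unfolding tt .
  qed
  have Gt: "G t = t"
  proof -
    have "of_real N * ((G t - t) * (G t + t)) = 0" using GW[OF tH] tt unfolding tfix by (simp add: algebra_simps)
    moreover have "Im (G t + t) > 0" using G(2)[OF tH] tH by (simp add: upper_half_plane_def)
    then have "G t + t \<noteq> 0" by (metis less_irrefl zero_complex.sel(2))
    ultimately show ?thesis using N by simp
  qed
  have tn: "t + of_nat n \<in> ?H" for n using tH by (simp add: upper_half_plane_def)
  have Gtn: "G (t + of_nat n) = t + of_real s * of_nat n" for n
  proof (induction n)
    case 0 then show ?case using Gt by simp
  next
    case (Suc n)
    then show ?case using GT[OF tn[of n]] by (simp add: algebra_simps)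
  qed
  have ct: "cnj t = - t" by (simp add: t_def)
  have Gmap: "G z \<in> ?H" if "z \<in> ?H" for z using G(2)[OF that] by (simp add: upper_half_plane_def)
  \<comment> \<open>Equality in the Schwarz lemma at \<open>t + 1\<close>, whose image is
    \<open>t + s\<close>: since \<open>t\<close> is purely imaginary, \<open>2 t + 1\<close> and
    \<open>2 t - 1\<close> have the same modulus.\<close>
  have nm: "cmod (of_real s / (t + of_real s + t)) = cmod (1 / (t + 1 + t))"
  proof -
    have "cmod (t + of_real s + t) = cmod (t + 1 + t)"
      using s by (auto simp: t_def cmod_def)
    then show ?thesis using s by (auto simp: norm_divide)
  qed
  obtain \<alpha> where \<alpha>: "\<And>z. z \<in> ?H \<Longrightarrow> (G z - t) / (G z - cnj t) = \<alpha> * ((z - t) / (z - cnj t))"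
    by (rule upper_half_plane_Schwarz[OF G(1) Gmap tH Gt tn[of 1]])
       (use nm Gtn[of 1] in \<open>auto simp: ct\<close>)
  have two: "t + of_real r + t \<noteq> 0" if "r \<noteq> 0" for r using that by (auto simp: t_def complex_eq_iff)
  from s show False
  proof
    assume s: "s = 1"
    have "\<alpha> = 1" using \<alpha>[OF tn[of 1]] Gtn[of 1] s two[of 1] by (simp add: ct)
    have "(G a - t) / (G a + t) = (a - t) / (a + t)" using \<alpha>[OF a(1)] \<open>\<alpha> = 1\<close> by (simp add: ct)
    moreover have "G a + t \<noteq> 0" "a + t \<noteq> 0"
      using G(2)[OF a(1)] a(1) tH by (auto simp: upper_half_plane_def complex_eq_iff)
    ultimately have "t * (G a - a) = 0" by (simp add: field_simps)
    then have "G a = a" using tH by (auto simp: upper_half_plane_def)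
    then show False using G(3)[OF a(1)] s a(2) by simp
  next
    \<comment> \<open>On the points \<open>t + n\<close> the map \<open>G\<close> now agrees with
      the reflection in the imaginary axis, which is not holomorphic. Accordingly
      \<open>t + 1\<close> and \<open>t + 2\<close> demand different rotations unless
      \<open>t = 0\<close>.\<close>
    assume s: "s = -1"
    have "G (t + 1) = t - 1" "G (t + 2) = t - 2" using Gtn[of 1] Gtn[of 2] s by simp_all
    then have 1: "(t - 1 - t) / (t - 1 + t) = \<alpha> * ((t + 1 - t) / (t + 1 + t))"
      and 2: "(t - 2 - t) / (t - 2 + t) = \<alpha> * ((t + 2 - t) / (t + 2 + t))"
      using \<alpha>[OF tn[of 1]] \<alpha>[OF tn[of 2]] unfolding ct by simp_all
    have ne: "t - 1 + t \<noteq> 0" "t + 1 + t \<noteq> 0" "t - 2 + t \<noteq> 0" "t + 2 + t \<noteq> 0"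
      by (auto simp: t_def complex_eq_iff)
    have "- (2 * t + 1) = \<alpha> * (2 * t - 1)" using 1 ne by (simp add: field_simps)
    moreover have "2 * (- (2 * t + 2)) = 2 * (\<alpha> * (2 * t - 2))" using 2 ne by (simp add: field_simps)
    then have "- (2 * t + 2) = \<alpha> * (2 * t - 2)" by (simp only: mult_cancel_left) simp
    ultimately have "- (2 * t + 1) * (2 * t - 2) = - (2 * t + 2) * (2 * t - 1)" by simp
    then have "t = 0" by (simp add: algebra_simps)
    then show False using tH by (simp add: upper_half_plane_def)
  qed
qed

section \<open>The transformation law of E2\<close>

text \<open>Both series rearrange the absolutely convergent double series of
  \<open>d * x ^ (m * d)\<close> over positive \<open>m\<close> and \<open>d\<close>: summing over
  \<open>d\<close> first gives the left one, collecting the terms with \<open>m * d = n\<close> the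
  divisor sums. Indices are shifted by one throughout.\<close>

lemma Lambert_sigma1:
  fixes x :: complex
  assumes x: "cmod x < 1"
  obtains S where "(\<lambda>m. x ^ Suc m / (1 - x ^ Suc m)\<^sup>2) sums S"
    and "(\<lambda>n. of_nat (sigma1 (Suc n)) * x ^ Suc n) sums S"
proof -
  define G :: "nat \<times> nat \<Rightarrow> complex" where "G = (\<lambda>(m, d). of_nat (Suc d) * x ^ (Suc m * Suc d))"
  define F :: "nat \<times> nat \<Rightarrow> complex" where "F = (\<lambda>(n, e). of_nat e * x ^ Suc n)"
  define r where "r = cmod x"
  have r: "0 \<le> r" "r < 1" using x by (auto simp: r_def)
  have row: "(\<lambda>d. of_nat (Suc d) * y ^ (Suc m * Suc d)) sums (y ^ Suc m / (1 - y ^ Suc m)\<^sup>2)"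
    if "norm y < 1" for y :: "'a :: {real_normed_field, banach}" and m
  proof -
    define c where "c = y ^ Suc m"
    have "norm c < 1" using that by (simp add: c_def norm_power power_less_one_iff del: power_Suc)
    from sums_mult[OF geometric_deriv_sums[OF this], of c]
    have "(\<lambda>d. c * (of_nat (Suc d) * c ^ d)) sums (c * (1 / (1 - c)\<^sup>2))" .
    moreover have "y ^ (Suc m * Suc d) = c * c ^ d" for d
      by (simp only: c_def power_mult power_Suc[of "y ^ Suc m"])
    ultimately show ?thesis unfolding c_def[symmetric] by (simp add: mult_ac)
  qed
  have nrow: "(\<lambda>d. norm (G (m, d))) = (\<lambda>d. of_nat (Suc d) * r ^ (Suc m * Suc d))" for m
    by (simp add: G_def norm_mult norm_power r_def del: of_nat_Suc)
  have rowG: "((\<lambda>d. G (m, d)) has_sum (x ^ Suc m / (1 - x ^ Suc m)\<^sup>2)) UNIV" for m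
  proof (rule norm_summable_imp_has_sum)
    show "summable (\<lambda>d. norm (G (m, d)))" unfolding nrow using row[of r m] r by (auto simp: sums_iff)
    show "(\<lambda>d. G (m, d)) sums (x ^ Suc m / (1 - x ^ Suc m)\<^sup>2)" using row[OF x, of m] by (simp add: G_def)
  qed
  have "(\<lambda>z. norm (G z)) summable_on (UNIV \<times> UNIV)"
  proof (rule summable_on_SigmaI)
    show "((\<lambda>d. norm (G (m, d))) has_sum (r ^ Suc m / (1 - r ^ Suc m)\<^sup>2)) UNIV" for m
      using row[of r m] r unfolding nrow by (intro sums_nonneg_imp_has_sum) auto
    show "(\<lambda>m. r ^ Suc m / (1 - r ^ Suc m)\<^sup>2) summable_on UNIV"
    proof (rule norm_summable_imp_summable_on, rule summable_comparison_test')
      show "summable (\<lambda>m. r ^ Suc m / (1 - r)\<^sup>2)"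
        using r by (intro summable_divide) (simp add: summable_geometric summable_mult)
      fix m
      have "r ^ Suc m \<le> r" using r by (simp add: mult_left_le power_le_one)
      then have "(1 - r)\<^sup>2 \<le> (1 - r ^ Suc m)\<^sup>2" using r by (intro power_mono) auto
      then show "norm (norm (r ^ Suc m / (1 - r ^ Suc m)\<^sup>2)) \<le> r ^ Suc m / (1 - r)\<^sup>2"
        using r \<open>r ^ Suc m \<le> r\<close> by (simp add: norm_divide norm_power del: power_Suc)
           (intro divide_left_mono mult_pos_pos zero_less_power; simp del: power_Suc)
    qed
  qed simp
  then have "G summable_on (UNIV \<times> UNIV)" by (rule abs_summable_summable)
  then obtain S where S: "(G has_sum S) (UNIV \<times> UNIV)" by (auto simp: summable_on_def)
  have "((\<lambda>m. x ^ Suc m / (1 - x ^ Suc m)\<^sup>2) has_sum S) UNIV"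
    by (rule has_sum_SigmaD[OF S]) (use rowG in auto)
  then have 1: "(\<lambda>m. x ^ Suc m / (1 - x ^ Suc m)\<^sup>2) sums S" by (rule has_sum_imp_sums)
  \<comment> \<open>The pair \<open>(m, d)\<close> stands for the factorization
    \<open>Suc n = Suc m * Suc d\<close> and is sent to \<open>n\<close> with its divisor
    \<open>Suc d\<close>; the subtractions of 1 undo the index shift.\<close>
  let ?\<phi> = "\<lambda>(m, d). (Suc m * Suc d - 1, Suc d)"
  let ?\<psi> = "\<lambda>(n, e). (Suc n div e - 1, e - 1)"
  let ?D = "Sigma UNIV (\<lambda>n. {e. e dvd Suc n})"
  have bij: "bij_betw ?\<phi> (UNIV \<times> UNIV) ?D"
  proof (rule bij_betw_byWitness[where f' = ?\<psi>])
    show "\<forall>a\<in>UNIV \<times> UNIV. ?\<psi> (?\<phi> a) = a" by (auto simp del: mult_Suc mult_Suc_right)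
    show "\<forall>a\<in>?D. ?\<phi> (?\<psi> a) = a"
    proof
      fix a assume "a \<in> ?D"
      then obtain n e where a: "a = (n, e)" and e: "e dvd Suc n" by blast
      have "e > 0" using dvd_pos_nat[OF _ e] by simp
      have "Suc n div e > 0" using dvd_imp_le[OF e] \<open>e > 0\<close> by (simp add: div_greater_zero_iff)
      then show "?\<phi> (?\<psi> a) = a" using e \<open>e > 0\<close> unfolding a by (simp del: mult_Suc mult_Suc_right)
    qed
    show "?\<phi> ` (UNIV \<times> UNIV) \<subseteq> ?D" by (auto simp del: mult_Suc mult_Suc_right)
  qed simp
  have "G = (\<lambda>z. F (?\<phi> z))" by (auto simp: G_def F_def fun_eq_iff simp del: mult_Suc mult_Suc_right power_Suc)
  then have "(F has_sum S) ?D"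
    using S has_sum_reindex_bij_betw[OF bij, of F S] by simp
  from has_sum_SigmaD[OF this, of "\<lambda>n. of_nat (sigma1 (Suc n)) * x ^ Suc n"]
  have "((\<lambda>n. of_nat (sigma1 (Suc n)) * x ^ Suc n) has_sum S) UNIV"
    by (simp add: F_def sigma1_def has_sum_finiteI sum_distrib_right del: power_Suc)
  then have "(\<lambda>n. of_nat (sigma1 (Suc n)) * x ^ Suc n) sums S" by (rule has_sum_imp_sums)
  with 1 show ?thesis by (rule that)
qed

lemma norm_exp_2pi_i_less_1:
  assumes "Im \<tau> > 0" shows "cmod (exp (2 * of_real pi * \<i> * \<tau>)) < 1"
  using assms by (simp add: norm_exp_eq_Re)

lemma E2_holomorphic: "E2 holomorphic_on upper_half_plane"
proof -
  define g where "g x = (\<Sum>n. of_nat (sigma1 (Suc n)) * x ^ Suc n)" for x :: complex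
  have "g holomorphic_on ball 0 1"
  proof (rule power_series_holomorphic[where a = "\<lambda>n. of_nat (sigma1 n)"])
    fix w :: complex assume "w \<in> ball 0 1"
    then have "cmod w < 1" by simp
    then obtain S where "(\<lambda>n. of_nat (sigma1 (Suc n)) * w ^ Suc n) sums S"
      by (rule Lambert_sigma1)
    then have "(\<lambda>n. of_nat (sigma1 (Suc n)) * w ^ Suc n) sums g w" by (simp add: g_def sums_iff)
    \<comment> \<open>The power series also has a term at \<open>n = 0\<close>. It vanishes because
      every number divides 0 and a sum over an infinite set is 0 by convention, so
      \<open>sigma1 0 = 0\<close>.\<close>
    then show "(\<lambda>n. of_nat (sigma1 n) * (w - 0) ^ n) sums g w"
      using sums_Suc_iff[of "\<lambda>n. of_nat (sigma1 n) * w ^ n" "g w"] by (simp add: sigma1_def)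
  qed
  then have "(g \<circ> (\<lambda>\<tau>. exp (2 * of_real pi * \<i> * \<tau>))) holomorphic_on upper_half_plane"
    by (rule holomorphic_on_compose_gen[rotated])
       (use norm_exp_2pi_i_less_1 in \<open>auto intro!: holomorphic_intros simp: upper_half_plane_def\<close>)
  then have "(\<lambda>\<tau>. 1 - 24 * g (exp (2 * of_real pi * \<i> * \<tau>))) holomorphic_on upper_half_plane"
    by (intro holomorphic_intros) (simp add: o_def)
  then show ?thesis by (simp add: E2_def[abs_def] g_def)
qed

lemma E2_plus_1: "E2 (\<tau> + 1) = E2 \<tau>"
  by (simp add: E2_def ring_distribs exp_add)

section \<open>Cotangent sums over half of a lattice\<close>

definition ee :: "complex \<Rightarrow> complex" where "ee z = exp (2 * of_real pi * \<i> * z)"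

lemma ee_add: "ee (z + w) = ee z * ee w"
  by (simp add: ee_def ring_distribs exp_add)

lemma ee_minus: "ee (- z) = 1 / ee z"
  by (simp add: ee_def exp_minus inverse_eq_divide)

lemma ee_of_int [simp]: "ee (of_int n) = 1"
  unfolding ee_def using exp_integer_2pi[of "of_int n"] by (simp add: mult_ac)

lemma ee_1 [simp]: "ee 1 = 1"
  using ee_of_int[of 1] by simp

lemma ee_nonzero [simp]: "ee z \<noteq> 0"
  by (simp add: ee_def)

lemma norm_ee: "cmod (ee z) = exp (- 2 * pi * Im z)"
  by (simp add: ee_def norm_exp_eq_Re)

lemma norm_ee_less_1: "Im z > 0 \<Longrightarrow> cmod (ee z) < 1"
  by (simp add: norm_ee)

lemma ee_eq_1_iff: "ee z = 1 \<longleftrightarrow> (\<exists>n::int. z = of_int n)"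
proof -
  have "ee z = 1 \<longleftrightarrow> (\<exists>n::int. 2 * of_real pi * \<i> * z = (of_int (2 * n) * pi) * \<i>)"
    unfolding ee_def using exp_eq[of "2 * of_real pi * \<i> * z" 0] by simp
  also have "\<dots> \<longleftrightarrow> (\<exists>n::int. z = of_int n)"
    by (intro ex_cong1) (auto simp: field_simps)
  finally show ?thesis .
qed

text \<open>Its terms are \<open>\<i>/2 cot (\<pi> (z + m \<tau>)) - 1/2\<close>, where subtracting
  1/2 makes the series converge. It carries the poles in the lattice rows
  \<open>\<int> - m \<tau>\<close> with \<open>m \<ge> 0\<close>. At a pole the offending term is 0
  by the convention for division.\<close>

definition half_sum :: "complex \<Rightarrow> complex \<Rightarrow> complex" where
  "half_sum \<tau> z = (\<Sum>m. ee \<tau> ^ m * ee z / (1 - ee \<tau> ^ m * ee z))"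

lemma summable_half_sum:
  assumes \<tau>: "Im \<tau> > 0"
  shows "summable (\<lambda>m. ee \<tau> ^ m * ee z / (1 - ee \<tau> ^ m * ee z))"
proof -
  have q: "cmod (ee \<tau>) < 1" using \<tau> by (rule norm_ee_less_1)
  have "(\<lambda>m. ee \<tau> ^ m * ee z) \<longlonglongrightarrow> 0"
    using tendsto_mult[OF LIMSEQ_power_zero[OF q] tendsto_const, of "ee z"] by simp
  then have "(\<lambda>m. cmod (ee \<tau> ^ m * ee z)) \<longlonglongrightarrow> 0" by (rule tendsto_norm_zero)
  then have "\<forall>\<^sub>F m in sequentially. cmod (ee \<tau> ^ m * ee z) < 1/2" by (rule order_tendstoD) simp
  then have "\<forall>\<^sub>F m in sequentially. cmod (ee \<tau> ^ m * ee z / (1 - ee \<tau> ^ m * ee z)) \<le> 2 * cmod (ee z) * cmod (ee \<tau>) ^ m"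
  proof eventually_elim
    case (elim m)
    define x where "x = ee \<tau> ^ m * ee z"
    have "1/2 \<le> cmod (1 - x)" using elim norm_triangle_ineq2[of 1 x] by (simp add: x_def)
    then have "cmod x / cmod (1 - x) \<le> cmod x / (1/2)" by (intro divide_left_mono) auto
    then show ?case by (simp add: x_def norm_mult norm_power norm_divide mult_ac)
  qed
  moreover have "summable (\<lambda>m. 2 * cmod (ee z) * cmod (ee \<tau>) ^ m)"
    using q by (intro summable_mult summable_geometric) simp
  ultimately show ?thesis by (rule summable_comparison_test_ev)
qed

lemma half_sum_add_period:
  assumes "Im \<tau> > 0"
  shows "half_sum \<tau> z = ee z / (1 - ee z) + half_sum \<tau> (z + \<tau>)"
  unfolding half_sum_def using suminf_split_head[OF summable_half_sum[OF assms, of z]]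
  by (simp add: ee_add mult_ac)

lemma half_sum_plus_1: "half_sum \<tau> (z + 1) = half_sum \<tau> z"
  by (simp add: half_sum_def ee_add)

lemma has_field_derivative_half_sum:
  assumes \<tau>: "Im \<tau> > 0" and z: "Im z > 0"
  shows "(\<lambda>m. 2 * of_real pi * \<i> * (ee \<tau> ^ m * ee z) / (1 - ee \<tau> ^ m * ee z)\<^sup>2) sums deriv (half_sum \<tau>) z"
    and "(half_sum \<tau> has_field_derivative deriv (half_sum \<tau>) z) (at z)"
proof -
  define f where "f m z = ee \<tau> ^ m * ee z / (1 - ee \<tau> ^ m * ee z)" for m z
  define f' where "f' m z = 2 * of_real pi * \<i> * (ee \<tau> ^ m * ee z) / (1 - ee \<tau> ^ m * ee z)\<^sup>2" for m z
  have q: "cmod (ee \<tau>) < 1" using \<tau> by (rule norm_ee_less_1)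
  have less: "cmod (ee \<tau> ^ m * ee z) \<le> cmod (ee z)" for m z
    using q by (simp add: norm_mult norm_power mult_left_le_one_le power_le_one)
  have ne: "1 - ee \<tau> ^ m * ee z \<noteq> 0" if "Im z > 0" for m z
    using less[of m z] norm_ee_less_1[OF that] by force
  have "\<exists>g g'. \<forall>x\<in>{z. Im z > 0}. ((\<lambda>n. f n x) sums g x) \<and> ((\<lambda>n. f' n x) sums g' x) \<and> (g has_field_derivative g' x) (at x)"
  proof (rule series_and_derivative_comparison_complex)
    show "open {z. Im z > 0}" by (rule open_halfspace_Im_gt)
    show "(f n has_field_derivative f' n x) (at x)" if "x \<in> {z. Im z > 0}" for n x
    proof -
      have "((\<lambda>z. ee \<tau> ^ n * ee z) has_field_derivative 2 * of_real pi * \<i> * (ee \<tau> ^ n * ee x)) (at x)"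
        unfolding ee_def[of x] ee_def[of "z" for z] by (rule derivative_eq_intros refl | simp)+
      note d = this
      have "1 - ee \<tau> ^ n * ee x \<noteq> 0" using ne that by simp
      from DERIV_divide[OF d DERIV_diff[OF DERIV_const d] this]
      show ?thesis unfolding f_def[abs_def] f'_def by (simp add: power2_eq_square algebra_simps)
    qed
    fix x assume x: "x \<in> {z. Im z > 0}"
    \<comment> \<open>On the disc of radius \<open>Im x / 2\<close> about \<open>x\<close> the
      imaginary part stays above \<open>Im x / 2\<close>, so \<rho> bounds \<open>ee\<close> there.
      This makes the comparison series uniform on the disc.\<close>
    define \<rho> where "\<rho> = exp (- pi * Im x)"
    have \<rho>: "0 < \<rho>" "\<rho> < 1" using x by (auto simp: \<rho>_def)
    define h where "h n = cmod (ee \<tau>) ^ n * (\<rho> / (1 - \<rho>))" for n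
    have h0: "h n \<ge> 0" for n using \<rho> by (simp add: h_def)
    have "cmod (f n y) \<le> h n" if "y \<in> ball x (Im x / 2)" for n y
    proof -
      have "\<bar>Im (x - y)\<bar> < Im x / 2" using that abs_Im_le_cmod[of "x - y"] by (simp add: dist_norm)
      then have "Im y \<ge> Im x / 2" unfolding minus_complex.sel by linarith
      then have y: "cmod (ee y) \<le> \<rho>" by (simp add: norm_ee \<rho>_def field_simps)
      define w where "w = ee \<tau> ^ n * ee y"
      have "cmod w \<le> \<rho>" using less[of n y] y by (simp add: w_def)
      then have "1 - \<rho> \<le> cmod (1 - w)" using norm_triangle_ineq2[of 1 w] by simp
      moreover have "cmod w \<le> cmod (ee \<tau>) ^ n * \<rho>" using y by (simp add: w_def norm_mult norm_power mult_left_mono)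
      ultimately have "cmod w / cmod (1 - w) \<le> cmod (ee \<tau>) ^ n * \<rho> / (1 - \<rho>)"
        using \<rho> by (intro frac_le) auto
      then show ?thesis by (simp add: f_def h_def w_def norm_divide)
    qed
    moreover have "summable (\<lambda>n. complex_of_real (h n))"
      unfolding h_def using q by (intro summable_of_real summable_mult2 summable_geometric) simp
    ultimately show "\<exists>d h. 0 < d \<and> summable h \<and> range h \<subseteq> \<real>\<^sub>\<ge>\<^sub>0 \<and>
        (\<forall>\<^sub>F n in sequentially. \<forall>y\<in>ball x d \<inter> {z. Im z > 0}. cmod (f n y) \<le> cmod (h n))"
      using x h0 by (intro exI[of _ "Im x / 2"] exI[of _ "\<lambda>n. complex_of_real (h n)"]) (auto intro!: always_eventually)
  qed
  then obtain g g' where g: "\<And>x. Im x > 0 \<Longrightarrow> (\<lambda>n. f n x) sums g x" "\<And>x. Im x > 0 \<Longrightarrow> (\<lambda>n. f' n x) sums g' x"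
    "\<And>x. Im x > 0 \<Longrightarrow> (g has_field_derivative g' x) (at x)" by auto
  have eq: "half_sum \<tau> x = g x" if "Im x > 0" for x
    using g(1)[OF that] by (simp add: half_sum_def f_def sums_iff)
  have "(half_sum \<tau> has_field_derivative g' z) (at z)"
    by (rule has_field_derivative_transform_within_open[OF g(3)[OF z] open_halfspace_Im_gt[of 0]])
       (use z eq in auto)
  moreover from this have "deriv (half_sum \<tau>) z = g' z" by (rule DERIV_imp_deriv)
  ultimately show "(\<lambda>m. 2 * of_real pi * \<i> * (ee \<tau> ^ m * ee z) / (1 - ee \<tau> ^ m * ee z)\<^sup>2) sums deriv (half_sum \<tau>) z"
    "(half_sum \<tau> has_field_derivative deriv (half_sum \<tau>) z) (at z)"
    using g(2)[OF z] by (simp_all add: f'_def)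
qed

text \<open>At \<open>z = \<tau>\<close> the differentiated series is \<open>2 \<pi> \<i>\<close>
  times the Lambert series of the divisor sums, and
  \<open>24 / (2 \<pi> \<i>) = 12 / (\<pi> \<i>)\<close>.\<close>

lemma deriv_half_sum_period:
  assumes \<tau>: "Im \<tau> > 0"
  shows "E2 \<tau> = 1 - 12 / (of_real pi * \<i>) * deriv (half_sum \<tau>) \<tau>"
proof -
  obtain S where S: "(\<lambda>m. ee \<tau> ^ Suc m / (1 - ee \<tau> ^ Suc m)\<^sup>2) sums S"
    "(\<lambda>n. of_nat (sigma1 (Suc n)) * ee \<tau> ^ Suc n) sums S"
    using Lambert_sigma1[OF norm_ee_less_1[OF \<tau>]] by blast
  have "(\<lambda>m. 2 * of_real pi * \<i> * (ee \<tau> ^ Suc m / (1 - ee \<tau> ^ Suc m)\<^sup>2)) sums deriv (half_sum \<tau>) \<tau>"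
    using has_field_derivative_half_sum(1)[OF \<tau> \<tau>] by (simp add: mult_ac)
  from sums_unique2[OF this sums_mult[OF S(1)]] have "deriv (half_sum \<tau>) \<tau> = 2 * of_real pi * \<i> * S" .
  moreover have "E2 \<tau> = 1 - 24 * S" using S(2) by (simp add: E2_def ee_def sums_iff)
  ultimately show ?thesis by (simp add: field_simps)
qed

section \<open>The cotangent function near its pole at 0\<close>

lemma exp_third_order: "((\<lambda>u::complex. (exp u - 1 - u - u\<^sup>2 / 2) / u ^ 3) \<longlongrightarrow> 1 / 6) (at 0)"
proof (rule LIM_zero_cancel, rule Lim_null_comparison)
  show "((\<lambda>u::complex. exp \<bar>Re u\<bar> * norm u / 6) \<longlongrightarrow> 0) (at 0)"
    by (auto intro!: tendsto_eq_intros)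
  have bound: "norm ((exp u - 1 - u - u\<^sup>2 / 2) / u ^ 3 - 1 / 6) \<le> exp \<bar>Re u\<bar> * norm u / 6"
    if "u \<noteq> 0" for u :: complex
  proof -
    have fact3: "fact 3 = (6 :: real)" "fact 3 = (6 :: complex)" by (simp_all add: fact_numeral)
    have "(\<Sum>k\<le>3. u ^ k / fact k) = 1 + u + u\<^sup>2 / 2 + u ^ 3 / 6"
      by (simp add: numeral_3_eq_3 fact3[unfolded numeral_3_eq_3] power2_eq_square)
    then have "norm (exp u - (1 + u + u\<^sup>2 / 2 + u ^ 3 / 6)) \<le> exp \<bar>Re u\<bar> * norm u ^ 4 / 6"
      using Taylor_exp[of u 3] fact3 by simp
    moreover have "(exp u - 1 - u - u\<^sup>2 / 2) / u ^ 3 - 1 / 6 = (exp u - (1 + u + u\<^sup>2 / 2 + u ^ 3 / 6)) / u ^ 3"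
      using that by (simp add: diff_divide_distrib add_divide_distrib)
    ultimately have "norm ((exp u - 1 - u - u\<^sup>2 / 2) / u ^ 3 - 1 / 6) \<le> (exp \<bar>Re u\<bar> * norm u ^ 4 / 6) / norm u ^ 3"
      by (simp only: norm_divide norm_power) (intro divide_right_mono, auto)
    also have "\<dots> = exp \<bar>Re u\<bar> * norm u / 6"
      using that by (simp add: power4_eq_xxxx power3_eq_cube)
    finally show ?thesis .
  qed
  show "\<forall>\<^sub>F u in at 0. norm ((exp u - 1 - u - u\<^sup>2 / 2) / u ^ 3 - 1 / 6) \<le> exp \<bar>Re (u::complex)\<bar> * norm u / 6"
    using eventually_neq_at_within[of 0] by eventually_elim (rule bound)
qed

text \<open>This is \<open>\<i>/2 (cot (\<pi> z) - 1/(\<pi> z))\<close>, so its derivative at 0 is \<open>-\<pi>\<i>/6\<close>; that value supplies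
  the constant term of \<open>E2\<close>.\<close>
definition cot_part :: "complex \<Rightarrow> complex" where
  "cot_part z = (if z = 0 then 0 else 1 / 2 + ee z / (1 - ee z) + 1 / (2 * of_real pi * \<i> * z))"

lemma cot_part_0 [simp]: "cot_part 0 = 0"
  by (simp add: cot_part_def)

lemma cot_part_has_field_derivative_0:
  "(cot_part has_field_derivative - (of_real pi * \<i> / 6)) (at 0)"
proof -
  define h :: "complex \<Rightarrow> complex" where "h u = (if u = 0 then 0 else 1 / 2 + exp u / (1 - exp u) + 1 / u)" for u
  define g :: "complex \<Rightarrow> complex" where "g u = (exp u - 1 - u - u\<^sup>2 / 2) / u ^ 3" for u
  have g: "(g \<longlongrightarrow> 1 / 6) (at 0)" unfolding g_def by (rule exp_third_order)
  have e: "((\<lambda>u::complex. (exp u - 1) / u) \<longlongrightarrow> 1) (at 0)"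
    using DERIV_exp[of "0::complex"] by (simp add: has_field_derivative_iff)
  \<comment> \<open>Over the common denominator, \<open>h u\<close> has numerator
    \<open>2 (1 - exp u) + u (1 + exp u)\<close>, which vanishes to third order; hence the expansion
    of \<open>exp\<close> up to the cube. The limit is \<open>(1/2 - 2/6) / (-2)\<close>.\<close>
  have "((\<lambda>u. (1 / 2 - 2 * g u + u * g u) / (- 2 * ((exp u - 1) / u))) \<longlongrightarrow> - (1 / 12)) (at 0)"
    by (rule tendsto_eq_intros g e refl | simp)+
  moreover have "\<forall>\<^sub>F u in at 0. (1 / 2 - 2 * g u + u * g u) / (- 2 * ((exp u - 1) / u)) = (h u - h 0) / (u - 0)"
  proof -
    have "\<forall>\<^sub>F u in at (0::complex). (exp u - 1) / u \<noteq> 0"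
      using e by (rule tendsto_imp_eventually_ne) simp
    moreover have "\<forall>\<^sub>F u in at (0::complex). u \<noteq> 0" by (rule eventually_neq_at_within)
    ultimately show ?thesis
    proof eventually_elim
      case (elim u)
      define E where "E = exp u"
      have E: "E - 1 \<noteq> 0" "1 - E \<noteq> 0" "u \<noteq> 0" using elim by (auto simp: E_def)
      have "u ^ 3 * (1 / 2 - 2 * g u + u * g u) = u ^ 3 / 2 + (u - 2) * (E - 1 - u - u\<^sup>2 / 2)"
        using E by (simp add: g_def E_def field_simps)
      also have "\<dots> = 2 * (1 - E) + u * (1 + E)"
        by (simp add: power2_eq_square power3_eq_cube field_simps)
      finally have n: "1 / 2 - 2 * g u + u * g u = (2 * (1 - E) + u * (1 + E)) / u ^ 3"
        using E by (simp add: field_simps)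
      have "h u = (2 * (1 - E) + u * (1 + E)) / (2 * u * (1 - E))"
        using E by (simp add: h_def E_def[symmetric] field_simps)
      then have "(h u - h 0) / (u - 0) = (2 * (1 - E) + u * (1 + E)) / (2 * u * (1 - E) * u)"
        by (simp add: h_def)
      also have "\<dots> = (1 / 2 - 2 * g u + u * g u) / (- 2 * ((E - 1) / u))"
      proof -
        have "u ^ 3 * (- 2 * ((E - 1) / u)) = 2 * u * (1 - E) * u"
          using E by (simp add: power3_eq_cube field_simps)
        then show ?thesis unfolding n by (simp only: divide_divide_eq_left)
      qed
      finally show ?case by (simp add: E_def)
    qed
  qed
  ultimately have "((\<lambda>u. (h u - h 0) / (u - 0)) \<longlongrightarrow> - (1 / 12)) (at 0)" by (rule Lim_transform_eventually)
  then have "(h has_field_derivative - (1 / 12)) (at (2 * of_real pi * \<i> * 0))" by (simp add: has_field_derivative_iff)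
  moreover have "((\<lambda>z. 2 * of_real pi * \<i> * z) has_field_derivative 2 * of_real pi * \<i>) (at 0)"
    by (rule derivative_eq_intros refl | simp)+
  ultimately have "((\<lambda>z. h (2 * of_real pi * \<i> * z)) has_field_derivative - (1 / 12) * (2 * of_real pi * \<i>)) (at 0)"
    by (rule DERIV_chain2)
  moreover have "(\<lambda>z. h (2 * of_real pi * \<i> * z)) = cot_part"
    by (auto simp: h_def cot_part_def ee_def fun_eq_iff)
  ultimately show ?thesis by (simp add: mult.commute)
qed

text \<open>In the unit disc \<open>ee\<close> takes the value 1 only at 0, so 0 is an isolated
  singularity; the derivative found there gives continuity, which makes it removable.\<close>

lemma cot_part_analytic:
  assumes "z = 0 \<or> ee z \<noteq> 1" shows "cot_part analytic_on {z}"
proof -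
  let ?A = "{z. ee z \<noteq> 1}"
  have opn: "open ?A" unfolding ee_def by (intro open_Collect_neq continuous_intros)
  have "(\<lambda>z. 1 / 2 + ee z / (1 - ee z) + 1 / (2 * of_real pi * \<i> * z)) holomorphic_on ?A"
    unfolding ee_def[abs_def] by (intro holomorphic_intros) (auto simp: ee_def)
  moreover have "1 / 2 + ee z / (1 - ee z) + 1 / (2 * of_real pi * \<i> * z) = cot_part z" if "z \<in> ?A" for z
    using that by (auto simp: cot_part_def ee_def)
  ultimately have hol: "cot_part holomorphic_on ?A" by (rule holomorphic_transform)
  show ?thesis
  proof (cases "z = 0")
    case False
    then show ?thesis using assms hol opn by (auto simp: analytic_at)
  next
    case True
    have sub: "ball 0 1 - {0} \<subseteq> ?A"
    proof
      fix w :: complex assume w: "w \<in> ball 0 1 - {0}"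
      show "w \<in> ?A"
      proof (rule ccontr)
        assume "w \<notin> ?A"
        then obtain n :: int where n: "w = of_int n" by (auto simp: ee_eq_1_iff)
        then have "\<bar>real_of_int n\<bar> < 1" "n \<noteq> 0" using w by (auto simp: norm_of_int)
        then show False by linarith
      qed
    qed
    have "cot_part holomorphic_on ball 0 1"
    proof (rule no_isolated_singularity'[of "{0}"])
      show "(cot_part \<longlongrightarrow> cot_part w) (at w within ball 0 1)" if "w \<in> {0}" for w
        using DERIV_isCont[OF cot_part_has_field_derivative_0] that
        by (auto simp: isCont_def intro: tendsto_within_subset)
      show "cot_part holomorphic_on ball 0 1 - {0}" by (rule holomorphic_on_subset[OF hol sub])
    qed auto
    then show ?thesis using True by (auto simp: analytic_at intro!: exI[of _ "ball 0 1"])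
  qed
qed

section \<open>The zeta function of a lattice and its quasi-periods\<close>

text \<open>Up to a constant factor this is the Weierstrass zeta function of \<open>\<int> + \<int>\<tau>\<close> minus a linear function.\<close>
definition zeta_part :: "complex \<Rightarrow> complex \<Rightarrow> complex" where
  "zeta_part \<tau> z = 1 / 2 + half_sum \<tau> z - half_sum \<tau> (\<tau> - z)"

lemma zeta_part_plus_1: "zeta_part \<tau> (z + 1) = zeta_part \<tau> z"
proof -
  have "half_sum \<tau> (\<tau> - z) = half_sum \<tau> (\<tau> - (z + 1))"
    using half_sum_plus_1[of \<tau> "\<tau> - (z + 1)"] by simp
  then show ?thesis by (simp add: zeta_part_def half_sum_plus_1)
qed

text \<open>The shift drops the first term \<open>A\<close> of one half sum and adds a first term
  \<open>B\<close> to the other, and \<open>A + B = -1\<close>. The quasi-period 1 is what produces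
  the inhomogeneous term in the law of \<open>E2\<close>.\<close>

lemma zeta_part_plus_period:
  assumes \<tau>: "Im \<tau> > 0" and "ee z \<noteq> 1"
  shows "zeta_part \<tau> (z + \<tau>) = zeta_part \<tau> z + 1"
proof -
  define A where "A = ee z / (1 - ee z)"
  define B where "B = ee (- z) / (1 - ee (- z))"
  have "A + B = - 1"
    using assms(2) unfolding A_def B_def by (simp add: ee_minus divide_simps) (simp add: algebra_simps)
  then have B: "B = - 1 - A" by (simp add: eq_diff_eq add.commute)
  have "half_sum \<tau> z = A + half_sum \<tau> (z + \<tau>)" "half_sum \<tau> (- z) = B + half_sum \<tau> (\<tau> - z)"
    using half_sum_add_period[OF \<tau>, of z] half_sum_add_period[OF \<tau>, of "- z"]
    by (simp_all add: A_def B_def)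
  then show ?thesis by (simp add: zeta_part_def B)
qed

text \<open>Isolates the principal part at 0; what remains is regular there.\<close>

lemma zeta_part_eq_cot_part:
  assumes "Im \<tau> > 0" "z \<noteq> 0"
  shows "zeta_part \<tau> z = cot_part z - 1 / (2 * of_real pi * \<i> * z) + half_sum \<tau> (z + \<tau>) - half_sum \<tau> (\<tau> - z)"
  using half_sum_add_period[OF assms(1), of z] assms(2) by (simp add: zeta_part_def cot_part_def)

text \<open>In this strip \<open>z + \<tau>\<close> and \<open>\<tau> - z\<close> stay in the upper
  half-plane, where the half sums are holomorphic. Only the poles of \<open>cot_part\<close> at
  nonzero integers have to be excluded.\<close>

lemma zeta_regular_analytic:
  assumes \<tau>: "Im \<tau> > 0" and z: "\<bar>Im z\<bar> < Im \<tau>" "z = 0 \<or> ee z \<noteq> 1"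
  shows "(\<lambda>z. cot_part z + half_sum \<tau> (z + \<tau>) - half_sum \<tau> (\<tau> - z)) analytic_on {z}"
proof -
  have an: "half_sum \<tau> analytic_on {w}" if "Im w > 0" for w
  proof -
    have "half_sum \<tau> holomorphic_on {w. Im w > 0}"
      using has_field_derivative_half_sum(2)[OF \<tau>]
      by (subst holomorphic_on_open) (auto simp: open_halfspace_Im_gt)
    then show ?thesis using that open_halfspace_Im_gt[of 0] by (auto simp: analytic_at)
  qed
  have "(half_sum \<tau> \<circ> (\<lambda>z. z + \<tau>)) analytic_on {z}"
    by (rule analytic_on_compose) (use z an in \<open>auto intro!: analytic_intros\<close>)
  moreover have "(half_sum \<tau> \<circ> (\<lambda>z. \<tau> - z)) analytic_on {z}"
    by (rule analytic_on_compose) (use z an in \<open>auto intro!: analytic_intros\<close>)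
  ultimately show ?thesis unfolding o_def
    by (intro analytic_on_add analytic_on_diff cot_part_analytic z(2))
qed

text \<open>The two half sums contribute the same derivative, as the reflection cancels the minus
  sign; \<open>cot_part\<close> accounts for the constant term of \<open>E2\<close>.\<close>

lemma zeta_regular_has_field_derivative_0:
  assumes \<tau>: "Im \<tau> > 0"
  shows "((\<lambda>z. cot_part z + half_sum \<tau> (z + \<tau>) - half_sum \<tau> (\<tau> - z))
           has_field_derivative - (of_real pi * \<i> / 6) * E2 \<tau>) (at 0)"
proof -
  have "(half_sum \<tau> has_field_derivative deriv (half_sum \<tau>) \<tau>) (at (0 + \<tau>))"
    "(half_sum \<tau> has_field_derivative deriv (half_sum \<tau>) \<tau>) (at (\<tau> - 0))"
    using has_field_derivative_half_sum(2)[OF \<tau> \<tau>] by simp_all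
  note D = this
  have "((\<lambda>z. half_sum \<tau> (z + \<tau>)) has_field_derivative deriv (half_sum \<tau>) \<tau> * 1) (at 0)"
    by (rule DERIV_chain2[where g = "\<lambda>z. z + \<tau>" and x = 0, OF D(1)]) (auto intro!: derivative_eq_intros)
  moreover have "((\<lambda>z. half_sum \<tau> (\<tau> - z)) has_field_derivative deriv (half_sum \<tau>) \<tau> * (-1)) (at 0)"
    by (rule DERIV_chain2[where g = "\<lambda>z. \<tau> - z" and x = 0, OF D(2)]) (auto intro!: derivative_eq_intros)
  ultimately
  have "((\<lambda>z. cot_part z + half_sum \<tau> (z + \<tau>) - half_sum \<tau> (\<tau> - z)) has_field_derivative
      - (of_real pi * \<i> / 6) + deriv (half_sum \<tau>) \<tau> * 1 - deriv (half_sum \<tau>) \<tau> * (-1)) (at 0)"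
    by (intro DERIV_diff DERIV_add cot_part_has_field_derivative_0)
  moreover have "- (of_real pi * \<i> / 6) + D * 1 - D * (-1) = - (of_real pi * \<i> / 6) * (1 - 12 / (of_real pi * \<i>) * D)"
    for D :: complex by (simp add: field_simps)
  ultimately show ?thesis by (simp only: deriv_half_sum_period[OF \<tau>])
qed

text \<open>The difference of the zeta functions of \<open>\<int> + \<int>\<tau>\<close> and of its rescaling by \<open>1/\<tau>\<close> has no poles and
  becomes doubly periodic after subtraction of \<open>z/\<tau>\<close>, so it vanishes by Liouville's theorem;
  the transformation law is its linear coefficient at 0.\<close>
lemma E2_inversion:
  assumes \<tau>: "Im \<tau> > 0"
  shows "E2 (- 1 / \<tau>) = \<tau>\<^sup>2 * E2 \<tau> + 6 * \<tau> / (of_real pi * \<i>)"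
proof -
  define \<sigma> where "\<sigma> = - 1 / \<tau>"
  have \<tau>0: "\<tau> \<noteq> 0" using \<tau> by auto
  have \<sigma>: "Im \<sigma> > 0" using \<tau> \<tau>0
    by (simp add: \<sigma>_def Im_divide complex_eq_iff sum_power2_gt_zero_iff divide_neg_pos)
  define \<Lambda> where "\<Lambda> = {z. \<exists>m n :: int. z = of_int m + of_int n * \<tau>}"
  have \<Lambda>1: "z \<in> \<Lambda>" if "z + 1 \<in> \<Lambda>" for z
  proof -
    from that obtain m n :: int where "z + 1 = of_int m + of_int n * \<tau>" by (auto simp: \<Lambda>_def)
    then have "z = of_int (m - 1) + of_int n * \<tau>" by (simp add: algebra_simps)
    then show ?thesis unfolding \<Lambda>_def by blast
  qed
  have \<Lambda>1': "z + 1 \<in> \<Lambda>" if "z \<in> \<Lambda>" for z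
  proof -
    from that obtain m n :: int where "z = of_int m + of_int n * \<tau>" by (auto simp: \<Lambda>_def)
    then have "z + 1 = of_int (m + 1) + of_int n * \<tau>" by (simp add: algebra_simps)
    then show ?thesis unfolding \<Lambda>_def by blast
  qed
  have \<Lambda>\<tau>: "z \<in> \<Lambda>" if "z + \<tau> \<in> \<Lambda>" for z
  proof -
    from that obtain m n :: int where "z + \<tau> = of_int m + of_int n * \<tau>" by (auto simp: \<Lambda>_def)
    then have "z = of_int m + of_int (n - 1) * \<tau>" by (simp add: algebra_simps)
    then show ?thesis unfolding \<Lambda>_def by blast
  qed
  have \<Lambda>\<tau>': "z + \<tau> \<in> \<Lambda>" if "z \<in> \<Lambda>" for z
  proof -
    from that obtain m n :: int where "z = of_int m + of_int n * \<tau>" by (auto simp: \<Lambda>_def)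
    then have "z + \<tau> = of_int m + of_int (n + 1) * \<tau>" by (simp add: algebra_simps)
    then show ?thesis unfolding \<Lambda>_def by blast
  qed
  have int\<Lambda>: "of_int k \<in> \<Lambda>" "of_int k * \<tau> \<in> \<Lambda>" for k
    unfolding \<Lambda>_def by (auto intro: exI[of _ k] exI[of _ 0])
  have ee\<Lambda>: "ee z \<noteq> 1" "ee (z / \<tau>) \<noteq> 1" if "z \<notin> \<Lambda>" for z
    using that int\<Lambda> \<tau>0 by (auto simp: ee_eq_1_iff field_simps)
  \<comment> \<open>Translation by 1 moves \<open>z / \<tau>\<close> by \<open>-\<sigma>\<close>,
    translation by \<tau> moves it by 1; the term \<open>z / \<tau>\<close> offsets the quasi-period
    in both cases. The value 0 on \<Lambda> agrees with the regular expression \<open>R\<close> at 0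
    and keeps \<open>E\<close> periodic everywhere.\<close>
  define E where "E z = (if z \<in> \<Lambda> then 0 else zeta_part \<tau> z - zeta_part \<sigma> (z / \<tau>) / \<tau> - z / \<tau>)" for z
  have E1: "E (z + 1) = E z" for z
  proof (cases "z \<in> \<Lambda>")
    case False
    then have z1: "z + 1 \<notin> \<Lambda>" using \<Lambda>1 by blast
    have eq: "(z + 1) / \<tau> + \<sigma> = z / \<tau>" by (simp add: \<sigma>_def add_divide_distrib)
    have "zeta_part \<sigma> (z / \<tau>) = zeta_part \<sigma> ((z + 1) / \<tau>) + 1"
      using zeta_part_plus_period[OF \<sigma> ee\<Lambda>(2)[OF z1]] unfolding eq .
    then show ?thesis using False z1 by (simp add: E_def zeta_part_plus_1 add_divide_distrib)
  qed (simp add: E_def \<Lambda>1')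
  have E\<tau>: "E (z + \<tau>) = E z" for z
  proof (cases "z \<in> \<Lambda>")
    case False
    then have z1: "z + \<tau> \<notin> \<Lambda>" using \<Lambda>\<tau> by blast
    have eq: "(z + \<tau>) / \<tau> = z / \<tau> + 1" using \<tau>0 by (simp add: add_divide_distrib)
    show ?thesis using False z1 zeta_part_plus_period[OF \<tau> ee\<Lambda>(1)[OF False]]
      by (simp add: E_def eq zeta_part_plus_1)
  qed (simp add: E_def \<Lambda>\<tau>')
  have Em: "E (z + of_int m) = E z" for z m
  proof (induction m rule: int_induct[of _ 0])
    case (step1 i) then show ?case using E1[of "z + of_int i"] by (simp add: algebra_simps)
  next
    case (step2 i) then show ?case using E1[of "z + of_int (i - 1)"] by (simp add: algebra_simps)
  qed simp
  have En: "E (z + of_int n * \<tau>) = E z" for z n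
  proof (induction n rule: int_induct[of _ 0])
    case (step1 i) then show ?case using E\<tau>[of "z + of_int i * \<tau>"] by (simp add: algebra_simps)
  next
    case (step2 i) then show ?case using E\<tau>[of "z + of_int (i - 1) * \<tau>"] by (simp add: algebra_simps)
  qed simp
  \<comment> \<open>The region where the regular expressions of both zeta functions are available.
    Its only lattice point is 0.\<close>
  define P where "P = {z. \<bar>Im z\<bar> < Im \<tau> \<and> \<bar>Im (z / \<tau>)\<bar> < Im \<sigma>}"
  have "open P" unfolding P_def by (intro open_Collect_conj open_Collect_less continuous_intros) (use \<tau>0 in auto)
  have P\<Lambda>: "z = 0" if zP: "z \<in> P" and z\<Lambda>: "z \<in> \<Lambda>" for z
  proof -
    obtain m n :: int where z: "z = of_int m + of_int n * \<tau>" using z\<Lambda> by (auto simp: \<Lambda>_def)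
    have "\<bar>real_of_int n\<bar> * Im \<tau> < 1 * Im \<tau>" using zP \<tau> by (simp add: P_def z abs_mult)
    then have "n = 0" using \<tau> by (simp add: mult_less_cancel_right)
    have "z / \<tau> = - of_int m * \<sigma>" using \<open>n = 0\<close> by (simp add: z \<sigma>_def)
    then have "\<bar>real_of_int m\<bar> * Im \<sigma> < 1 * Im \<sigma>" using zP \<sigma> by (simp add: P_def abs_mult)
    then have "m = 0" using \<sigma> by (simp add: mult_less_cancel_right)
    then show ?thesis using \<open>n = 0\<close> z by simp
  qed
  define S where "S \<tau> z = cot_part z + half_sum \<tau> (z + \<tau>) - half_sum \<tau> (\<tau> - z)" for \<tau> z
  \<comment> \<open>No principal part is left: \<open>1 / z\<close> and
    \<open>(1 / (z / \<tau>)) / \<tau>\<close> are equal.\<close>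
  define R where "R z = S \<tau> z - S \<sigma> (z / \<tau>) / \<tau> - z / \<tau>" for z
  have ER: "E z = R z" if "z \<in> P" for z
  proof (cases "z = 0")
    case True
    then show ?thesis using int\<Lambda>(1)[of 0] by (simp add: E_def R_def S_def)
  next
    case False
    then have "z \<notin> \<Lambda>" using P\<Lambda> that by blast
    then show ?thesis using False \<tau>0
      by (simp add: E_def R_def S_def zeta_part_eq_cot_part[OF \<tau>] zeta_part_eq_cot_part[OF \<sigma>]
          diff_divide_distrib add_divide_distrib)
  qed
  have "R analytic_on {z}" if "z \<in> P" for z
  proof -
    have e: "z = 0 \<or> ee z \<noteq> 1" "z / \<tau> = 0 \<or> ee (z / \<tau>) \<noteq> 1" using P\<Lambda>[OF that] ee\<Lambda>[of z] by auto
    have "S \<tau> analytic_on {z}" unfolding S_def[abs_def]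
      by (rule zeta_regular_analytic) (use \<tau> that e in \<open>auto simp: P_def\<close>)
    moreover have "S \<sigma> analytic_on {z / \<tau>}" unfolding S_def[abs_def]
      by (rule zeta_regular_analytic) (use \<sigma> that e in \<open>auto simp: P_def\<close>)
    then have "(S \<sigma> \<circ> (\<lambda>z. z / \<tau>)) analytic_on {z}"
      by (intro analytic_on_compose) (use \<tau>0 in \<open>auto intro!: analytic_intros\<close>)
    ultimately show ?thesis unfolding R_def[abs_def] o_def using \<tau>0 by (intro analytic_intros) auto
  qed
  then have "R holomorphic_on P" using analytic_imp_holomorphic analytic_on_analytic_at by blast
  then have EP: "E holomorphic_on P" by (rule holomorphic_transform) (simp add: ER)
  \<comment> \<open>The closed period parallelogram centred at 0. Rounding both coordinates moves
    any point into it, so holomorphy and boundedness of \<open>E\<close> on \<open>K\<close> carry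
    over to the plane.\<close>
  define K where "K = (\<lambda>(s, t). of_real s + of_real t * \<tau>) ` ({-1/2..1/2} \<times> {-1/2..1/2})"
  have "compact K" unfolding K_def
    by (intro compact_continuous_image compact_Times) (auto intro!: continuous_intros simp: case_prod_unfold)
  have "K \<subseteq> P"
  proof
    fix z assume "z \<in> K"
    then obtain s t :: real where st: "z = of_real s + of_real t * \<tau>" "\<bar>s\<bar> \<le> 1/2" "\<bar>t\<bar> \<le> 1/2"
      by (auto simp: K_def)
    have "\<bar>Im z\<bar> = \<bar>t\<bar> * Im \<tau>" using \<tau> st by (simp add: abs_mult)
    moreover have "z / \<tau> = of_real t - of_real s * \<sigma>" using \<tau>0 st by (simp add: \<sigma>_def add_divide_distrib)
    then have "\<bar>Im (z / \<tau>)\<bar> = \<bar>s\<bar> * Im \<sigma>" using \<sigma> by (simp add: abs_mult)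
    moreover have "\<bar>t\<bar> * Im \<tau> < 1 * Im \<tau>" "\<bar>s\<bar> * Im \<sigma> < 1 * Im \<sigma>"
      using st \<tau> \<sigma> by (intro mult_strict_right_mono; simp)+
    ultimately show "z \<in> P" by (simp add: P_def)
  qed
  have red: "\<exists>l. z - l \<in> K \<and> (\<forall>w. E (w - l) = E w)" for z
  proof -
    define t where "t = Im z / Im \<tau>"
    define s where "s = Re z - t * Re \<tau>"
    have z: "z = of_real s + of_real t * \<tau>" using \<tau> by (simp add: s_def t_def complex_eq_iff)
    let ?l = "of_int (round s) + of_int (round t) * \<tau>"
    have "z - ?l = of_real (s - of_int (round s)) + of_real (t - of_int (round t)) * \<tau>"
      by (simp add: z algebra_simps)
    moreover have "\<bar>s - of_int (round s)\<bar> \<le> 1/2" "\<bar>t - of_int (round t)\<bar> \<le> 1/2"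
      using of_int_round_abs_le[of s] of_int_round_abs_le[of t] by (simp_all add: abs_minus_commute)
    ultimately have "z - ?l \<in> K" unfolding K_def
      by (intro image_eqI[of _ _ "(s - of_int (round s), t - of_int (round t))"] conjI) (unfold mem_Times_iff fst_conv snd_conv atLeastAtMost_iff abs_le_iff prod.case, (linarith | rule refl)+)
    moreover have "E (w - ?l) = E w" for w
      using Em[of "w - ?l" "round s"] En[of "w - ?l + of_int (round s)" "round t"] by (simp add: algebra_simps)
    ultimately show ?thesis by blast
  qed
  have "E holomorphic_on UNIV"
  proof (rule analytic_imp_holomorphic, subst analytic_on_analytic_at, intro ballI)
    fix z
    obtain l where l: "z - l \<in> K" "\<And>w. E (w - l) = E w" using red by blast
    have "E analytic_on {z - l}" using EP \<open>open P\<close> \<open>K \<subseteq> P\<close> l(1) by (auto simp: analytic_at)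
    then have "(E \<circ> (\<lambda>w. w - l)) analytic_on {z}"
      by (intro analytic_on_compose) (auto intro!: analytic_intros)
    then show "E analytic_on {z}" using l(2) by (simp add: o_def)
  qed
  moreover have "bounded (range E)"
  proof (rule bounded_subset)
    have "continuous_on K E"
      using EP \<open>K \<subseteq> P\<close> by (meson continuous_on_subset holomorphic_on_imp_continuous_on)
    then show "bounded (E ` K)" using \<open>compact K\<close> by (intro compact_imp_bounded compact_continuous_image)
    show "range E \<subseteq> E ` K"
    proof
      fix x assume "x \<in> range E"
      then obtain z where z: "x = E z" by auto
      obtain l where "z - l \<in> K" "E (z - l) = E z" using red by blast
      then show "x \<in> E ` K" using z by (metis imageI)
    qed
  qed
  ultimately obtain c where c: "\<And>z. E z = c" using Liouville_theorem[of E] by (auto simp: constant_on_def)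
  have "0 \<in> P" using \<tau> \<sigma> by (simp add: P_def)
  have "R z = c" if "z \<in> P" for z using ER[OF that] c by simp
  then have "(R has_field_derivative 0) (at 0)"
    using has_field_derivative_transform_within_open[OF DERIV_const \<open>open P\<close> \<open>0 \<in> P\<close>] by metis
  moreover have "(R has_field_derivative - (of_real pi * \<i> / 6) * E2 \<tau>
      - (- (of_real pi * \<i> / 6) * E2 \<sigma> * (1 / \<tau>)) / \<tau> - 1 / \<tau>) (at 0)"
  proof -
    have "(S \<sigma> has_field_derivative - (of_real pi * \<i> / 6) * E2 \<sigma>) (at (0 / \<tau>))"
      using zeta_regular_has_field_derivative_0[OF \<sigma>] unfolding S_def[abs_def] by simp
    moreover have "((\<lambda>z. z / \<tau>) has_field_derivative 1 / \<tau>) (at 0)"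
      by (rule DERIV_cdivide[OF DERIV_ident])
    ultimately have "((\<lambda>z. S \<sigma> (z / \<tau>)) has_field_derivative - (of_real pi * \<i> / 6) * E2 \<sigma> * (1 / \<tau>)) (at 0)"
      by (rule DERIV_chain2)
    moreover have "(S \<tau> has_field_derivative - (of_real pi * \<i> / 6) * E2 \<tau>) (at 0)"
      using zeta_regular_has_field_derivative_0[OF \<tau>] unfolding S_def[abs_def] .
    ultimately show ?thesis unfolding R_def[abs_def]
      by (intro DERIV_diff DERIV_cdivide DERIV_ident)
  qed
  ultimately have "0 = - (of_real pi * \<i> / 6) * E2 \<tau>
      - (- (of_real pi * \<i> / 6) * E2 \<sigma> * (1 / \<tau>)) / \<tau> - 1 / \<tau>" by (rule DERIV_unique)
  then have e1: "6 * \<tau>\<^sup>2 * (- (of_real pi * \<i> / 6) * E2 \<tau>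
      - (- (of_real pi * \<i> / 6) * E2 \<sigma> * (1 / \<tau>)) / \<tau> - 1 / \<tau>) = 0" by simp
  have e2: "6 * \<tau>\<^sup>2 * (- (of_real pi * \<i> / 6) * E2 \<tau>
      - (- (of_real pi * \<i> / 6) * E2 \<sigma> * (1 / \<tau>)) / \<tau> - 1 / \<tau>)
      = of_real pi * \<i> * E2 \<sigma> - (of_real pi * \<i> * \<tau>\<^sup>2 * E2 \<tau> + 6 * \<tau>)"
    using \<tau>0 by (simp add: field_simps power2_eq_square)
  have "of_real pi * \<i> * E2 \<sigma> - (of_real pi * \<i> * \<tau>\<^sup>2 * E2 \<tau> + 6 * \<tau>) = 0"
    by (rule trans[OF e2[symmetric] e1])
  then have "of_real pi * \<i> * E2 \<sigma> = of_real pi * \<i> * \<tau>\<^sup>2 * E2 \<tau> + 6 * \<tau>" by simp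
  then have "E2 \<sigma> = (of_real pi * \<i> * \<tau>\<^sup>2 * E2 \<tau> + 6 * \<tau>) / (of_real pi * \<i>)"
    by (simp add: eq_divide_eq mult_ac)
  then show ?thesis by (simp add: \<sigma>_def add_divide_distrib)
qed

section \<open>Zeros of quasi-modular forms\<close>

lemma E2_plus_of_nat: "E2 (\<tau> + of_nat n) = E2 \<tau>"
proof (induction n)
  case (Suc n)
  then show ?case using E2_plus_1[of "\<tau> + of_nat n"] by (simp add: algebra_simps)
qed simp

lemma E2N_plus_1: "E2N N (\<tau> + 1) = E2N N \<tau>"
  using E2_plus_of_nat[of "of_nat N * \<tau>" N] by (simp add: E2N_def E2_plus_1 distrib_left)

text \<open>The involution interchanges the two summands of \<open>E2N\<close>: their arguments
  become \<open>- 1 / (N \<tau>)\<close> and \<open>- 1 / \<tau>\<close>. Each inversion contributes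
  \<open>6 N \<tau> / (\<pi> \<i>)\<close> once weighted, and division by \<open>1 + N\<close>
  yields the constant \<open>C\<close> of the overview.\<close>

lemma E2N_fricke:
  assumes N: "N > 0" and \<tau>: "Im \<tau> > 0"
  shows "E2N N (- 1 / (of_nat N * \<tau>)) =
           of_nat N * \<tau>\<^sup>2 * E2N N \<tau> + 12 / (of_real pi * \<i> * (1 + of_nat N)) * of_nat N * \<tau>"
proof -
  have a: "E2 (- 1 / (of_nat N * \<tau>)) = (of_nat N * \<tau>)\<^sup>2 * E2 (of_nat N * \<tau>) + 6 * (of_nat N * \<tau>) / (of_real pi * \<i>)"
    using N \<tau> by (intro E2_inversion) simp
  have "of_nat N * (- 1 / (of_nat N * \<tau>)) = - 1 / \<tau>" using N by simp
  then have b: "E2 (of_nat N * (- 1 / (of_nat N * \<tau>))) = \<tau>\<^sup>2 * E2 \<tau> + 6 * \<tau> / (of_real pi * \<i>)"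
    using E2_inversion[OF \<tau>] by simp
  define M where "M = 1 + complex_of_nat N"
  define c where "c = complex_of_real pi * \<i>"
  show ?thesis unfolding E2N_def a b M_def[symmetric] c_def[symmetric]
    by (simp add: divide_inverse power2_eq_square algebra_simps)
qed

lemma E2N_holomorphic:
  assumes "N > 0" shows "E2N N holomorphic_on upper_half_plane"
proof -
  have "(E2 \<circ> (\<lambda>\<tau>. of_nat N * \<tau>)) holomorphic_on upper_half_plane"
    by (rule holomorphic_on_compose_gen[OF _ E2_holomorphic])
       (use assms in \<open>auto intro!: holomorphic_intros simp: upper_half_plane_def\<close>)
  then show ?thesis unfolding E2N_def[abs_def] o_def by (intro holomorphic_intros E2_holomorphic)
qed

section \<open>The two generators and the orbits of the group\<close>

lemma fricke_in_Gamma0_plus: "fricke N \<in> Gamma0_plus N"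
  unfolding Gamma0_plus_def by (rule generate.incl) simp

lemma translation_in_Gamma0_plus: "vector [vector [1, 1], vector [0, 1]] \<in> Gamma0_plus N"
proof -
  have "vector [vector [1, 1], vector [0, 1]] \<in> Gamma0 N"
    by (auto simp: Gamma0_def SL2Z_def carrier_SL2R forall_2)
  then show ?thesis unfolding Gamma0_plus_def by (intro generate.incl) simp
qed

lemma aut_factor_fricke: "aut_factor (fricke N) \<tau> = of_real (sqrt (of_nat N)) * \<tau>"
  by (simp add: aut_factor_def fricke_def)

lemma moeb_fricke: "moeb (fricke N) \<tau> = - 1 / (of_nat N * \<tau>)"
proof -
  have "complex_of_real (sqrt (of_nat N)) * complex_of_real (sqrt (of_nat N)) = of_nat N"
    by (simp flip: of_real_mult)
  then show ?thesis unfolding moeb_def aut_factor_fricke by (simp add: fricke_def flip: mult.assoc)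
qed

lemma aut_factor_translation: "aut_factor (vector [vector [1, 1], vector [0, 1]]) \<tau> = 1"
  by (simp add: aut_factor_def)

lemma moeb_translation: "moeb (vector [vector [1, 1], vector [0, 1]]) \<tau> = \<tau> + 1"
  unfolding moeb_def aut_factor_translation by simp

lemma modular_form_plus_1:
  assumes "modular_form (Gamma0_plus N) k f" "\<tau> \<in> upper_half_plane"
  shows "f (\<tau> + 1) = f \<tau>"
proof -
  have "slash k f (vector [vector [1, 1], vector [0, 1]]) \<tau> = f \<tau>"
    using assms translation_in_Gamma0_plus unfolding modular_form_def by blast
  then show ?thesis by (simp add: slash_def aut_factor_translation moeb_translation)
qed

lemma modular_form_fricke:
  assumes "N > 0" "modular_form (Gamma0_plus N) k f" "\<tau> \<in> upper_half_plane"
  shows "f (- 1 / (of_nat N * \<tau>)) = (of_real (sqrt (of_nat N)) * \<tau>) powi k * f \<tau>"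
proof -
  define j where "j = complex_of_real (sqrt (of_nat N)) * \<tau>"
  have "j \<noteq> 0" using assms(1,3) by (auto simp: j_def upper_half_plane_def)
  have "slash k f (fricke N) \<tau> = f \<tau>"
    using assms fricke_in_Gamma0_plus unfolding modular_form_def by blast
  then have "j powi (- k) * f (- 1 / (of_nat N * \<tau>)) = f \<tau>"
    by (simp add: slash_def aut_factor_fricke moeb_fricke j_def)
  then show ?thesis unfolding j_def[symmetric] using \<open>j \<noteq> 0\<close> by (simp add: power_int_minus field_simps)
qed

lemma finite_orbit_class_Int_compact:
  assumes "N > 0" "X \<in> Z // orbit_rel (Gamma0_plus N)" "Z \<subseteq> upper_half_plane"
    "compact K" "K \<subseteq> upper_half_plane"
  shows "finite (X \<inter> K)"
proof -
  obtain z where z: "z \<in> Z" "X = orbit_rel (Gamma0_plus N) `` {z}" using assms(2) by (auto elim: quotientE)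
  have "X \<inter> K \<subseteq> (\<lambda>A. moeb A z) ` Gamma0_plus N \<inter> K" using z by (auto simp: orbit_rel_def)
  moreover have "Im z > 0" using z assms(3) by (auto simp: upper_half_plane_def)
  ultimately show ?thesis using finite_orbit_Int_compact[of N z K] assms finite_subset by blast
qed

lemma orbit_rel_trans_moeb:
  assumes N: "N > 0" and A: "A \<in> Gamma0_plus N" and z: "(z, \<tau>) \<in> orbit_rel (Gamma0_plus N)"
  shows "(z, moeb A \<tau>) \<in> orbit_rel (Gamma0_plus N)"
proof -
  note sub = Gamma0_plus_subset_SL2R[OF N]
  obtain B where B: "B \<in> Gamma0_plus N" "\<tau> = moeb B z" and H: "z \<in> upper_half_plane" "\<tau> \<in> upper_half_plane"
    using z by (auto simp: orbit_rel_def)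
  have "A ** B \<in> Gamma0_plus N"
    using generate.eng[OF A[unfolded Gamma0_plus_def] B(1)[unfolded Gamma0_plus_def]]
    by (simp add: Gamma0_plus_def SL2R_def)
  moreover have "moeb A \<tau> = moeb (A ** B) z"
    using moeb_mult[of A B z] subsetD[OF sub A] subsetD[OF sub B(1)] B(2) H by (simp add: upper_half_plane_def)
  moreover have "moeb A \<tau> \<in> upper_half_plane" using moeb_in_upper_half_plane A H sub by blast
  ultimately show ?thesis using H by (auto simp: orbit_rel_def)
qed

lemma orbit_rel_moeb_cancel:
  assumes N: "N > 0" and A: "A \<in> Gamma0_plus N" and \<tau>: "\<tau> \<in> upper_half_plane"
    and z: "(z, moeb A \<tau>) \<in> orbit_rel (Gamma0_plus N)"
  shows "(z, \<tau>) \<in> orbit_rel (Gamma0_plus N)"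
proof -
  have gens: "insert (fricke N) (Gamma0 N) \<subseteq> carrier SL2R"
    using N fricke_in_SL2R by (auto simp: Gamma0_def SL2Z_def)
  have "inv\<^bsub>SL2R\<^esub> A \<in> Gamma0_plus N"
    using group.generate_m_inv_closed[OF group_SL2R gens] A by (simp add: Gamma0_plus_def)
  from orbit_rel_trans_moeb[OF N this z] show ?thesis
    using moeb_inv[of A \<tau>] A \<tau> Gamma0_plus_subset_SL2R[OF N] by (auto simp: upper_half_plane_def)
qed

text \<open>Writing \<open>h = p/f\<close>, the hypotheses say that \<open>h\<close> commutes with the translation and the Fricke
  involution, and \<open>h \<tau> = \<infinity>\<close> means that \<open>\<tau>\<close> is a zero of \<open>f\<close>.\<close>
lemma zero_in_orbit_if_value_is_cusp:
  fixes f p J :: "complex \<Rightarrow> complex"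
  assumes N: "N > 0" and x: "x \<in> fricke_cusps (of_nat N)"
    and T: "\<And>z. z \<in> upper_half_plane \<Longrightarrow> f (z + 1) = f z"
      "\<And>z. z \<in> upper_half_plane \<Longrightarrow> p (z + 1) = p z + f z"
    and J: "\<And>z. z \<in> upper_half_plane \<Longrightarrow> J z \<noteq> 0"
    and W: "\<And>z. z \<in> upper_half_plane \<Longrightarrow> f (- 1 / (of_nat N * z)) = J z * of_nat N * p z"
      "\<And>z. z \<in> upper_half_plane \<Longrightarrow> p (- 1 / (of_nat N * z)) = - J z * f z"
    and \<tau>: "\<tau> \<in> upper_half_plane" "f \<tau> \<noteq> 0" "p \<tau> = of_real x * f \<tau>"
  shows "\<exists>z. f z = 0 \<and> (z, \<tau>) \<in> orbit_rel (Gamma0_plus N)"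
  using x \<tau>
proof (induction arbitrary: \<tau> rule: fricke_cusps.induct)
  have sub: "fricke N \<in> carrier SL2R" using N by (rule fricke_in_SL2R)
  have wH: "- 1 / (of_nat N * z) \<in> upper_half_plane" if "z \<in> upper_half_plane" for z
    using moeb_in_upper_half_plane[OF sub that] by (simp add: moeb_fricke)
  {
    case zero
    \<comment> \<open>The value 0 of \<open>h\<close> means \<open>p \<tau> = 0\<close>, so the
      involution turns \<tau> into a zero of \<open>f\<close>.\<close>
    let ?z = "- 1 / (of_nat N * \<tau>)"
    have "f ?z = 0" using W(1)[OF zero(1)] zero(3) by simp
    moreover have "(?z, moeb (fricke N) \<tau>) \<in> orbit_rel (Gamma0_plus N)"
    proof -
      have "mat 1 \<in> Gamma0_plus N"
        using generate.one[of SL2R "insert (fricke N) (Gamma0 N)"] by (simp add: Gamma0_plus_def SL2R_def)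
      moreover have "moeb (mat 1) ?z = ?z" by (simp add: moeb_def aut_factor_def mat_def)
      ultimately show ?thesis using wH[OF zero(1)] by (force simp: orbit_rel_def moeb_fricke)
    qed
    then have "(?z, \<tau>) \<in> orbit_rel (Gamma0_plus N)"
      by (rule orbit_rel_moeb_cancel[OF N fricke_in_Gamma0_plus zero(1)])
    ultimately show ?case by blast
  next
    case (add1 x)
    have H: "\<tau> - 1 \<in> upper_half_plane" using add1.prems(1) by (simp add: upper_half_plane_def)
    have "f (\<tau> - 1) = f \<tau>" "p (\<tau> - 1) = p \<tau> - f \<tau>" using T[OF H] by simp_all
    then have "f (\<tau> - 1) \<noteq> 0" "p (\<tau> - 1) = of_real x * f (\<tau> - 1)"
      using add1.prems by (simp_all add: algebra_simps)
    then obtain z where "f z = 0" "(z, \<tau> - 1) \<in> orbit_rel (Gamma0_plus N)" using add1.IH[OF H] by blast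
    then show ?case
      using orbit_rel_trans_moeb[OF N translation_in_Gamma0_plus, of z "\<tau> - 1"] by (auto simp: moeb_translation)
  next
    case (diff1 x)
    have H: "\<tau> + 1 \<in> upper_half_plane" using diff1.prems(1) by (simp add: upper_half_plane_def)
    have "f (\<tau> + 1) \<noteq> 0" "p (\<tau> + 1) = of_real x * f (\<tau> + 1)"
      using diff1.prems T[OF diff1.prems(1)] by (simp_all add: algebra_simps)
    then obtain z where "f z = 0" "(z, \<tau> + 1) \<in> orbit_rel (Gamma0_plus N)" using diff1.IH[OF H] by blast
    then show ?case
      using orbit_rel_moeb_cancel[OF N translation_in_Gamma0_plus diff1.prems(1), of z] by (auto simp: moeb_translation)
  next
    case (invol x)
    \<comment> \<open>The value of \<open>h\<close> at \<tau> is \<open>- 1 / (N * x)\<close>, so by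
      equivariance it is \<open>x\<close> at \<open>?z\<close>, where the induction hypothesis
      applies.\<close>
    let ?z = "- 1 / (of_nat N * \<tau>)"
    have fz: "f ?z = - J \<tau> * f \<tau> / of_real x"
      using W(1)[OF invol.prems(1)] invol.prems(3) N by simp
    have "f ?z \<noteq> 0" unfolding fz using invol J by simp
    moreover have "p ?z = of_real x * f ?z"
      unfolding fz using W(2)[OF invol.prems(1)] invol.hyps by simp
    ultimately obtain z where "f z = 0" "(z, ?z) \<in> orbit_rel (Gamma0_plus N)"
      using invol.IH[OF wH[OF invol.prems(1)]] by blast
    then show ?case
      using orbit_rel_moeb_cancel[OF N fricke_in_Gamma0_plus invol.prems(1), of z] by (auto simp: moeb_fricke)
  }
qed

lemma infinite_orbits_of_zeros:
  fixes f p J :: "complex \<Rightarrow> complex"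
  assumes N: "N \<in> {2, 3}"
    and p: "p holomorphic_on upper_half_plane" and f: "f holomorphic_on upper_half_plane"
    and T: "\<And>z. z \<in> upper_half_plane \<Longrightarrow> f (z + 1) = f z"
      "\<And>z. z \<in> upper_half_plane \<Longrightarrow> p (z + 1) = p z + f z"
    and J: "\<And>z. z \<in> upper_half_plane \<Longrightarrow> J z \<noteq> 0"
    and W: "\<And>z. z \<in> upper_half_plane \<Longrightarrow> f (- 1 / (of_nat N * z)) = J z * of_nat N * p z"
      "\<And>z. z \<in> upper_half_plane \<Longrightarrow> p (- 1 / (of_nat N * z)) = - J z * f z"
    and a: "a \<in> upper_half_plane" "p a \<noteq> a * f a"
  shows "infinite ({\<tau> \<in> upper_half_plane. f \<tau> = 0} // orbit_rel (Gamma0_plus N))"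
proof
  let ?H = upper_half_plane
  let ?Q = "{\<tau> \<in> ?H. f \<tau> = 0} // orbit_rel (Gamma0_plus N)"
  assume fin: "finite ?Q"
  have N0: "N > 0" using N by auto
  obtain t where t: "t \<in> ?H" "f t \<noteq> 0" "Im (p t / f t) = 0"
    using quotient_real_somewhere[of "of_nat N" p f J a] N0 p f T J W a by auto
  have "open (?H \<inter> f -` (- {0}))"
    using continuous_open_preimage[OF holomorphic_on_imp_continuous_on[OF f] open_upper_half_plane, of "- {0}"]
    by (simp add: open_Compl)
  then obtain r where r: "r > 0" "cball t r \<subseteq> ?H \<inter> f -` (- {0})"
    using t unfolding open_contains_cball by blast
  then have ball: "ball t r \<subseteq> ?H \<inter> f -` (- {0})" by (meson ball_subset_cball subset_trans)
  define h where "h z = p z / f z" for z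
  have hol: "h holomorphic_on ball t r"
    unfolding h_def using ball
    by (intro holomorphic_on_divide holomorphic_on_subset[OF p] holomorphic_on_subset[OF f]) auto
  \<comment> \<open>A constant value would continue to \<open>p = c f\<close> on the whole
    half-plane, whereas \<open>p / f\<close> grows by 1 from \<open>t\<close> to
    \<open>t + 1\<close>.\<close>
  have "\<not> h constant_on ball t r"
  proof
    assume "h constant_on ball t r"
    then obtain c where c: "\<And>z. z \<in> ball t r \<Longrightarrow> h z = c" by (auto simp: constant_on_def)
    have pc: "p z = c * f z" if "z \<in> ?H" for z
    proof (rule analytic_continuation_open[of "ball t r" ?H p "\<lambda>z. c * f z"])
      show "p z = c * f z" if "z \<in> ball t r" for z
      proof -
        have "f z \<noteq> 0" using ball that by blast
        then show ?thesis using c[OF that] by (simp add: h_def field_simps)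
      qed
    qed (use r ball that open_upper_half_plane connected_upper_half_plane p f in \<open>auto intro!: holomorphic_intros\<close>)
    have "t + 1 \<in> ?H" using t by (simp add: upper_half_plane_def)
    from pc[OF this] pc[OF t(1)] T[OF t(1)] t(2) show False by simp
  qed
  then have "open (h ` ball t r)" using open_mapping_thm[OF hol] by simp
  moreover have "h t \<in> h ` ball t r" using r by simp
  ultimately obtain e where e: "e > 0" "ball (h t) e \<subseteq> h ` ball t r" unfolding open_contains_ball by blast
  define D where "D = {x \<in> fricke_cusps (of_nat N). Re (h t) - e < x \<and> x < Re (h t) + e}"
  have infD: "infinite D" unfolding D_def
    by (rule infinite_fricke_cusps_interval) (use N e in auto)
  have ht: "h t = of_real (Re (h t))" using t(3) by (simp add: h_def complex_eq_iff)
  have "\<exists>z\<in>ball t r. h z = of_real x" if "x \<in> D" for x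
  proof -
    have "dist (h t) (of_real x) < e"
      using that by (subst ht) (auto simp: D_def dist_norm abs_less_iff simp flip: of_real_diff)
    then have "complex_of_real x \<in> h ` ball t r" using e by auto
    then show ?thesis by (metis imageE)
  qed
  \<comment> \<open>Preimages under \<open>h\<close> of distinct cusps are distinct, so the disc
    contains infinitely many points equivalent to zeros of \<open>f\<close>.\<close>
  then obtain s where s: "\<And>x. x \<in> D \<Longrightarrow> s x \<in> ball t r" "\<And>x. x \<in> D \<Longrightarrow> h (s x) = of_real x" by metis
  have "inj_on s D" by (rule inj_onI) (metis s(2) of_real_eq_iff)
  then have "infinite (s ` D)" using infD finite_imageD by blast
  moreover have "s ` D \<subseteq> (\<Union>X\<in>?Q. X \<inter> cball t r)"
  proof
    fix \<tau> assume "\<tau> \<in> s ` D"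
    then obtain x where x: "x \<in> D" "\<tau> = s x" by auto
    have \<tau>: "\<tau> \<in> ball t r" "h \<tau> = of_real x" using s x by auto
    then have H: "\<tau> \<in> ?H" "f \<tau> \<noteq> 0" using ball by auto
    then have "p \<tau> = of_real x * f \<tau>" using \<tau>(2) by (simp add: h_def field_simps)
    then obtain z where z: "f z = 0" "(z, \<tau>) \<in> orbit_rel (Gamma0_plus N)"
      using zero_in_orbit_if_value_is_cusp[where x = x and J = J and f = f and p = p, OF N0 _ T J W H] x(1)
      by (auto simp: D_def)
    then have "z \<in> {\<tau> \<in> ?H. f \<tau> = 0}" by (auto simp: orbit_rel_def)
    then have "orbit_rel (Gamma0_plus N) `` {z} \<in> ?Q" by (rule quotientI)
    moreover have "\<tau> \<in> orbit_rel (Gamma0_plus N) `` {z} \<inter> cball t r" using z \<tau> by auto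
    ultimately show "\<tau> \<in> (\<Union>X\<in>?Q. X \<inter> cball t r)" by blast
  qed
  moreover have "finite (\<Union>X\<in>?Q. X \<inter> cball t r)"
    by (rule finite_UN_I[OF fin], rule finite_orbit_class_Int_compact[OF N0 _ _ compact_cball]) (use r in auto)
  ultimately show False using finite_subset by blast
qed

theorem theorem2p1:
  fixes N :: nat and k :: int and f :: "complex \<Rightarrow> complex"
  assumes "N \<in> {2, 3}"
    and "quasimodular_form_depth1 N k f"
  shows "infinite ({\<tau> \<in> upper_half_plane. f \<tau> = 0} // orbit_rel (Gamma0_plus N))"
proof -
  have N: "N > 0" using assms(1) by auto
  obtain f0 f1 a where f0: "modular_form (Gamma0_plus N) k f0" and f1: "modular_form (Gamma0_plus N) (k - 2) f1"
    and a: "a \<in> upper_half_plane" "f1 a \<noteq> 0"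
    and f: "\<And>\<tau>. \<tau> \<in> upper_half_plane \<Longrightarrow> f \<tau> = f0 \<tau> + f1 \<tau> * E2N N \<tau>"
    using assms(2) unfolding quasimodular_form_depth1_def by blast
  \<comment> \<open>\<open>f\<close> is prescribed only on the upper half-plane; \<open>F\<close> is
    given by the formula everywhere.\<close>
  define F where "F \<tau> = f0 \<tau> + f1 \<tau> * E2N N \<tau>" for \<tau>
  define C where "C = 12 / (of_real pi * \<i> * (1 + of_nat N))"
  have C: "C \<noteq> 0" 
  proof -
    have "1 + of_nat N \<noteq> (0 :: complex)" by (metis of_nat_0_neq of_nat_Suc)
    then show ?thesis by (simp add: C_def)
  qed
  define p where "p \<tau> = \<tau> * F \<tau> + C * f1 \<tau>" for \<tau>
  define j where "j \<tau> = complex_of_real (sqrt (of_nat N)) * \<tau>" for \<tau>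
  \<comment> \<open>The factor of \<open>f1\<close> is \<open>q = j powi (k - 2)\<close> and that of
    \<open>f0\<close> is \<open>q N \<tau>\<^sup>2\<close>. Taking \<open>q N \<tau>\<close> out of
    the transformed \<open>F\<close> leaves exactly \<open>p\<close>, whence
    \<open>J = q \<tau>\<close>.\<close>
  define J where "J \<tau> = j \<tau> powi (k - 2) * \<tau>" for \<tau>
  have hol: "f0 holomorphic_on upper_half_plane" "f1 holomorphic_on upper_half_plane"
    using f0 f1 by (auto simp: modular_form_def)
  have F: "F holomorphic_on upper_half_plane"
    unfolding F_def by (intro holomorphic_intros hol E2N_holomorphic N)
  have W: "F (- 1 / (of_nat N * \<tau>)) = J \<tau> * of_nat N * p \<tau>" "p (- 1 / (of_nat N * \<tau>)) = - J \<tau> * F \<tau>"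
    and J: "J \<tau> \<noteq> 0" if \<tau>: "\<tau> \<in> upper_half_plane" for \<tau>
  proof -
    have j0: "j \<tau> \<noteq> 0" and \<tau>0: "\<tau> \<noteq> 0" using N \<tau> by (auto simp: j_def upper_half_plane_def)
    then show "J \<tau> \<noteq> 0" by (simp add: J_def)
    define q where "q = j \<tau> powi (k - 2)"
    have jj: "(j \<tau>)\<^sup>2 = of_nat N * \<tau>\<^sup>2" by (simp add: j_def power_mult_distrib flip: of_real_power)
    have "j \<tau> powi k = j \<tau> powi (k - 2) * j \<tau> powi 2" using power_int_add[of "j \<tau>" "k - 2" 2] j0 by simp
    then have jk: "j \<tau> powi k = q * (of_nat N * \<tau>\<^sup>2)" by (simp add: q_def jj)
    have e: "E2N N (- 1 / (of_nat N * \<tau>)) = of_nat N * \<tau>\<^sup>2 * E2N N \<tau> + C * of_nat N * \<tau>"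
      unfolding C_def by (rule E2N_fricke) (use N \<tau> in \<open>auto simp: upper_half_plane_def\<close>)
    have m: "f0 (- 1 / (of_nat N * \<tau>)) = q * (of_nat N * \<tau>\<^sup>2) * f0 \<tau>" "f1 (- 1 / (of_nat N * \<tau>)) = q * f1 \<tau>"
      using modular_form_fricke[OF N f0 \<tau>] modular_form_fricke[OF N f1 \<tau>] jk by (simp_all add: q_def j_def)
    show W1: "F (- 1 / (of_nat N * \<tau>)) = J \<tau> * of_nat N * p \<tau>"
      unfolding F_def m e p_def J_def q_def[symmetric] by (simp add: algebra_simps power2_eq_square)
    \<comment> \<open>The first summand simplifies to \<open>- q * p \<tau>\<close>, whose part
      \<open>- q * C * f1 \<tau>\<close> cancels the second summand.\<close>
    have "p (- 1 / (of_nat N * \<tau>)) = - 1 / (of_nat N * \<tau>) * (J \<tau> * of_nat N * p \<tau>) + C * (q * f1 \<tau>)"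
      unfolding p_def[of "- 1 / (of_nat N * \<tau>)"] W1 m ..
    also have "- 1 / (of_nat N * \<tau>) * (J \<tau> * of_nat N * p \<tau>) = - q * p \<tau>"
      using N \<tau>0 by (simp add: J_def q_def)
    also have "- q * p \<tau> + C * (q * f1 \<tau>) = - J \<tau> * F \<tau>"
      by (simp add: p_def J_def q_def algebra_simps)
    finally show "p (- 1 / (of_nat N * \<tau>)) = - J \<tau> * F \<tau>" .
  qed
  have FT: "F (\<tau> + 1) = F \<tau>" if "\<tau> \<in> upper_half_plane" for \<tau>
    using modular_form_plus_1[OF f0 that] modular_form_plus_1[OF f1 that] by (simp add: F_def E2N_plus_1)
  have "infinite ({\<tau> \<in> upper_half_plane. F \<tau> = 0} // orbit_rel (Gamma0_plus N))"
  proof (rule infinite_orbits_of_zeros[OF assms(1) _ F FT _ J W a(1)])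
    show "p holomorphic_on upper_half_plane" unfolding p_def by (intro holomorphic_intros F hol)
    show "p (z + 1) = p z + F z" if "z \<in> upper_half_plane" for z
      using FT[OF that] modular_form_plus_1[OF f1 that] by (simp add: p_def algebra_simps)
    show "p a \<noteq> a * F a" using a(2) C by (simp add: p_def)
  qed
  moreover have "{\<tau> \<in> upper_half_plane. F \<tau> = 0} = {\<tau> \<in> upper_half_plane. f \<tau> = 0}"
    using f by (auto simp: F_def)
  ultimately show ?thesis by simp
qed

end
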